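(* Let $F$ be a finite forest and let $\mathcal{P}$ be a minimum caterpillar partition of $F$. Then \[\gamma_{gr}(F)=|V(F)|-|\mathcal{P}|,\] where $|\mathcal{P}|$ is the number of parts of $\mathcal{P}$.
   Context: For a graph $G$, a sequence of vertices $S=(v_1,\dots,v_k)$ is a legal sequence if for every $i\in[k]$, $N[v_i]\setminus\bigcup_{j=1}^{i-1}N[v_j]\neq\emptyset$ (here $N[v]$ is the closed neighborhood). The Grundy domination number $\gamma_{gr}(G)$ is the maximum length of a legal sequence of $G$. A caterpillar is a tree $C$ such that, for a maximum (longest) path $P$ of $C$, every vertex of $C$ is at distance at most $1$ from $P$. For a forest $F$, a minimum caterpillar partition of $F$ is a partition $\mathcal{P}=\{C_1,\dots,C_\ell\}$ of the set of non-isolated vertices of $F$ such that: (1) for every $i$, the subgraph of $F$ induced by $C_i$ is a caterpillar; (2) if for some $i\neq j$ there is an edge of $F$ between a vertex of $C_i$ and a vertex of $C_j$, then that edge is incident to a vertex which is a non-leaf vertex of the induced subgraph on $C_i$ or a non-leaf vertex of the induced subgraph on $C_j$; (3) among all partitions satisfying (1) and (2), $\mathcal{P}$ has the minimum number of parts. *)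

theory Defs
  imports "Graph_Theory.Graph_Theory" "HOL-Library.Disjoint_Sets"
begin

text \<open>
  A finite simple graph is a \<^locale>\<open>graph\<close>: a finite, symmetric, loop-free digraph without
  parallel arcs, where an undirected edge is a pair of opposite arcs.
\<close>

definition closed_nbhd :: "('a,'b) pre_digraph \<Rightarrow> 'a \<Rightarrow> 'a set" where
  "closed_nbhd G v = insert v {w. v \<rightarrow>\<^bsub>G\<^esub> w}"

definition legal_sequence :: "('a,'b) pre_digraph \<Rightarrow> 'a list \<Rightarrow> bool" where
  "legal_sequence G vs \<longleftrightarrow> set vs \<subseteq> verts G \<and>
    (\<forall>i<length vs. closed_nbhd G (vs ! i) - (\<Union>j<i. closed_nbhd G (vs ! j)) \<noteq> {})"

definition grundy_domination_number :: "('a,'b) pre_digraph \<Rightarrow> nat" where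
  "grundy_domination_number G = Max {length vs | vs. legal_sequence G vs}"

text \<open>
  The library predicates \<^const>\<open>forest\<close> and \<^const>\<open>tree\<close> are not usable here: in a symmetric
  digraph every edge already yields a \<open>cycle\<close> of length 2 in the sense of the library. In a
  \<^locale>\<open>graph\<close>, the cycles of the undirected graph are those of length at least 3.
\<close>

definition undirected_forest :: "('a,'b) pre_digraph \<Rightarrow> bool" where
  "undirected_forest G \<longleftrightarrow> graph G \<and> \<not> (\<exists>p. pre_digraph.cycle G p \<and> 3 \<le> length p)"

definition undirected_tree :: "('a,'b) pre_digraph \<Rightarrow> bool" where
  "undirected_tree G \<longleftrightarrow> connected G \<and> undirected_forest G"

definition longest_path :: "('a,'b) pre_digraph \<Rightarrow> 'a list \<Rightarrow> bool" where
  "longest_path G p \<longleftrightarrow> vpath p G \<and> (\<forall>q. vpath q G \<longrightarrow> vwalk_length q \<le> vwalk_length p)"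

definition graph_dist :: "('a,'b) pre_digraph \<Rightarrow> 'a \<Rightarrow> 'a \<Rightarrow> ereal" where
  "graph_dist G u v = wf_digraph.\<mu> G (\<lambda>_. 1) u v"

definition caterpillar :: "('a,'b) pre_digraph \<Rightarrow> bool" where
  "caterpillar G \<longleftrightarrow> undirected_tree G \<and>
    (\<exists>p. longest_path G p \<and> (\<forall>v\<in>verts G. \<exists>u\<in>set p. graph_dist G v u \<le> 1))"

definition non_isolated_verts :: "('a,'b) pre_digraph \<Rightarrow> 'a set" where
  "non_isolated_verts G = {v \<in> verts G. \<exists>w. v \<rightarrow>\<^bsub>G\<^esub> w}"

text \<open>
  In a \<^locale>\<open>graph\<close> the degree of a vertex is its \<^const>\<open>out_degree\<close>. A leaf is a vertex of
  degree 1, so the vertex of a one-vertex graph is not a leaf.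
\<close>

definition non_leaf :: "('a,'b) pre_digraph \<Rightarrow> 'a \<Rightarrow> bool" where
  "non_leaf G v \<longleftrightarrow> v \<in> verts G \<and> out_degree G v \<noteq> 1"

definition caterpillar_partition :: "('a,'b) pre_digraph \<Rightarrow> 'a set set \<Rightarrow> bool" where
  "caterpillar_partition F P \<longleftrightarrow>
    partition_on (non_isolated_verts F) P \<and>
    (\<forall>C\<in>P. caterpillar (F \<restriction> C)) \<and>
    (\<forall>C\<in>P. \<forall>D\<in>P. C \<noteq> D \<longrightarrow>
      (\<forall>u\<in>C. \<forall>v\<in>D. u \<rightarrow>\<^bsub>F\<^esub> v \<longrightarrow> non_leaf (F \<restriction> C) u \<or> non_leaf (F \<restriction> D) v))"

definition minimum_caterpillar_partition :: "('a,'b) pre_digraph \<Rightarrow> 'a set set \<Rightarrow> bool" where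
  "minimum_caterpillar_partition F P \<longleftrightarrow>
    caterpillar_partition F P \<and> (\<forall>Q. caterpillar_partition F Q \<longrightarrow> card P \<le> card Q)"

end

theory Submission
  imports Defs
begin

text \<open>
  Joining each vertex of a legal sequence of length \<open>k\<close> to the vertex it footprints yields
  \<open>|V| - k\<close> disjoint paths in the forest that cover everything except the vertices footprinting
  themselves, which form an independent set. Attaching the latter to adjacent paths gives
  caterpillars; if the number of paths plus the number of uncovered vertices is minimal, an edge
  between leaves of two different parts cannot exist, since it would allow us to join two paths or
  to extend one.

  Conversely, orient a dominating path in each caterpillar, let each of its vertices but the last
  footprint its successor, and let all vertices outside the paths footprint themselves. The order
  constraints for a legal sequence are acyclic inside the caterpillars, and adding back an edge
  between two of them creates a cycle of constraints only if both ends footprint themselves, that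
  is, only if both are leaves.
\<close>

section \<open>Paths and caterpillars in forests\<close>

definition link_path :: "('a \<times> 'a) set \<Rightarrow> 'a list \<Rightarrow> bool" where
  "link_path E p \<longleftrightarrow> p \<noteq> [] \<and> distinct p \<and> (\<forall>i. Suc i < length p \<longrightarrow> (p ! i, p ! Suc i) \<in> E)"

text \<open>Both orientations are included so that this is a symmetric relation to which
  \<open>bridge\<close> can be applied.\<close>

definition path_edges :: "'a list \<Rightarrow> ('a \<times> 'a) set" where
  "path_edges p = {(p ! i, p ! Suc i) | i. Suc i < length p} \<union> {(p ! Suc i, p ! i) | i. Suc i < length p}"

text \<open>Forests are the simple graphs all of whose edges are bridges; this is the only form in which
  acyclicity is used.\<close>

locale forest_rel =
  fixes E :: "('a \<times> 'a) set"
  assumes sym_E: "sym E" and irrefl_E: "(x, x) \<notin> E"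
    and bridge: "\<lbrakk>D \<subseteq> E; sym D; (x, y) \<in> E; (x, y) \<in> D\<^sup>*\<rbrakk> \<Longrightarrow> (x, y) \<in> D"

definition spine :: "('a \<times> 'a) set \<Rightarrow> 'a set \<Rightarrow> 'a list \<Rightarrow> bool" where
  "spine E C p \<longleftrightarrow> link_path E p \<and> set p \<subseteq> C \<and> (\<forall>x\<in>C - set p. \<exists>y\<in>set p. (x, y) \<in> E)"

lemma link_path_singleton [simp]: "link_path E [x]"
  by (simp add: link_path_def)

lemma sym_path_edges: "sym (path_edges p)"
  by (auto simp: path_edges_def sym_def)

lemma path_edges_subset: "\<lbrakk>sym E; link_path E p\<rbrakk> \<Longrightarrow> path_edges p \<subseteq> E"
  by (auto simp: path_edges_def link_path_def sym_def)

lemma path_edges_in_set: "(x, y) \<in> path_edges p \<Longrightarrow> x \<in> set p \<and> y \<in> set p"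
  by (auto simp: path_edges_def)

lemma path_edges_connected:
  assumes "x \<in> set p" "y \<in> set p"
  shows "(x, y) \<in> (path_edges p)\<^sup>*"
proof -
  have hd: "(p ! 0, p ! i) \<in> (path_edges p)\<^sup>*" if "i < length p" for i
    using that
  proof (induction i)
    case (Suc i)
    then have "(p ! i, p ! Suc i) \<in> path_edges p"
      by (auto simp: path_edges_def)
    with Suc show ?case
      by (meson Suc_lessD rtrancl.rtrancl_into_rtrancl)
  qed simp
  have "sym ((path_edges p)\<^sup>*)"
    by (simp add: sym_path_edges sym_rtrancl)
  with hd assms show ?thesis
    by (metis in_set_conv_nth rtrancl_trans symE)
qed

lemma path_edges_nth:
  assumes "distinct p" "i < length p" "(p ! i, y) \<in> path_edges p"
  shows "(Suc i < length p \<and> y = p ! Suc i) \<or> (0 < i \<and> y = p ! (i - 1))"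
  using assms by (auto simp: path_edges_def nth_eq_iff_index_eq)

lemma link_path_append:
  assumes "link_path E p" "link_path E q" "set p \<inter> set q = {}" "(last p, hd q) \<in> E"
  shows "link_path E (p @ q)"
  unfolding link_path_def
proof (intro conjI allI impI)
  show "p @ q \<noteq> []" "distinct (p @ q)"
    using assms by (auto simp: link_path_def)
  fix i assume i: "Suc i < length (p @ q)"
  consider "Suc i < length p" | "Suc i = length p" | "length p \<le> i"
    by linarith
  then show "((p @ q) ! i, (p @ q) ! Suc i) \<in> E"
  proof cases
    case 1 with assms(1) show ?thesis by (simp add: link_path_def nth_append)
  next
    case 2
    then have "p ! i = last p" "q ! 0 = hd q"
      using assms(1,2) by (auto simp: link_path_def last_conv_nth hd_conv_nth simp flip: 2)
    with 2 assms(4) show ?thesis by (simp add: nth_append)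
  next
    case 3
    with assms(2) i show ?thesis by (simp add: link_path_def nth_append Suc_diff_le)
  qed
qed

lemma link_path_rev:
  assumes "sym E" "link_path E p"
  shows "link_path E (rev p)"
  unfolding link_path_def
proof (intro conjI allI impI)
  show "rev p \<noteq> []" "distinct (rev p)"
    using assms by (auto simp: link_path_def)
  fix i assume i: "Suc i < length (rev p)"
  let ?j = "length p - Suc (Suc i)"
  have "(p ! ?j, p ! Suc ?j) \<in> E"
    using assms(2) i by (simp add: link_path_def)
  moreover have "rev p ! i = p ! Suc ?j" "rev p ! Suc i = p ! ?j"
    using i by (auto simp: rev_nth Suc_diff_Suc)
  ultimately show "(rev p ! i, rev p ! Suc i) \<in> E"
    using assms(1) by (auto dest: symD)
qed

lemma link_path_orient:
  assumes "sym E" "link_path E p" "u \<in> {hd p, last p}"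
  obtains q where "link_path E q" "set q = set p" "last q = u"
proof (cases "u = last p")
  case False
  with assms show ?thesis
    by (intro that[of "rev p"]) (auto simp: link_path_rev last_rev)
qed (use assms that in auto)

text \<open>The walk is made simple while it is built: if the new first vertex already lies on the
  path, everything before its occurrence is dropped.\<close>

lemma rtrancl_imp_link_path:
  assumes "(x, y) \<in> r\<^sup>*"
  obtains p where "link_path r p" "hd p = x" "last p = y"
proof -
  from assms have "\<exists>p. link_path r p \<and> hd p = x \<and> last p = y"
  proof (induction rule: converse_rtrancl_induct)
    case base
    show ?case by (rule exI[of _ "[y]"]) simp
  next
    case (step x z)
    then obtain p where p: "link_path r p" "hd p = z" "last p = y" by blast
    show ?case
    proof (cases "x \<in> set p")
      case False
      then have "link_path r ([x] @ p)"
        by (intro link_path_append) (use step p in auto)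
      with p show ?thesis
        by (intro exI[of _ "x # p"]) (auto simp: link_path_def)
    next
      case True
      then obtain k where k: "k < length p" "p ! k = x" by (metis in_set_conv_nth)
      have "link_path r (drop k p)"
        using p(1) k(1) by (auto simp: link_path_def)
      with p k show ?thesis
        by (intro exI[of _ "drop k p"]) (auto simp: hd_drop_conv_nth)
    qed
  qed
  with that show thesis by blast
qed

context forest_rel
begin

lemma link_path_rev': "link_path E p \<Longrightarrow> link_path E (rev p)"
  using link_path_rev sym_E by blast

lemma edge_sym: "(x, y) \<in> E \<Longrightarrow> (y, x) \<in> E"
  using sym_E by (auto dest: symD)

text \<open>A chord would join two vertices already connected along the path, so it would not be a
  bridge.\<close>

lemma edge_in_path:
  assumes "link_path E p" "x \<in> set p" "y \<in> set p" "(x, y) \<in> E"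
  shows "(x, y) \<in> path_edges p"
  using bridge[OF path_edges_subset[OF sym_E assms(1)] sym_path_edges assms(4)]
    path_edges_connected[OF assms(2,3)] by blast

text \<open>A second edge from \<open>x\<close> into \<open>C\<close> would close a cycle:
  \<open>x\<close> reaches \<open>y\<close> through \<open>a\<close>, along the spine, and by at
  most one attaching edge.\<close>

lemma pendant_edges:
  assumes sp: "spine E C p" and x: "x \<in> C - set p" and y: "y \<in> C" and xy: "(x, y) \<in> E"
    and a: "a \<in> set p" "(x, a) \<in> E"
  shows "y = a"
proof -
  \<comment> \<open>\<open>D\<close> consists of the spine, the edge \<open>(x, a)\<close> and, if
    \<open>y\<close> is off the spine, an edge from \<open>y\<close> to a spine vertex
    \<open>b\<close>; otherwise \<open>b\<close> is \<open>y\<close>. The only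
    \<open>D\<close>-neighbour of \<open>x\<close> is \<open>a\<close>, so once
    \<open>bridge\<close> puts \<open>(x, y)\<close> into \<open>D\<close>, \<open>y\<close> is
    \<open>a\<close>.\<close>
  obtain b D where D: "D \<subseteq> E" "sym D" "path_edges p \<subseteq> D" "(x, a) \<in> D" "b \<in> set p" "(b, y) \<in> D\<^sup>*"
    "\<And>z. (x, z) \<in> D \<Longrightarrow> z = a"
  proof (cases "y \<in> set p")
    case True
    show ?thesis
    proof (rule that[of "path_edges p \<union> {(x, a), (a, x)}" y])
      show "path_edges p \<union> {(x, a), (a, x)} \<subseteq> E"
        using sp a edge_sym path_edges_subset[OF sym_E] by (auto simp: spine_def)
      show "sym (path_edges p \<union> {(x, a), (a, x)})"
        using sym_path_edges[of p] by (auto simp: sym_def)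
    qed (use True x a in \<open>auto dest: path_edges_in_set\<close>)
  next
    case False
    with sp y obtain b where b: "b \<in> set p" "(y, b) \<in> E" by (auto simp: spine_def)
    have ne: "x \<noteq> y" using xy irrefl_E by auto
    show ?thesis
    proof (rule that[of "path_edges p \<union> {(x, a), (a, x), (y, b), (b, y)}" b])
      show "path_edges p \<union> {(x, a), (a, x), (y, b), (b, y)} \<subseteq> E"
        using sp a b edge_sym path_edges_subset[OF sym_E] by (auto simp: spine_def)
      show "sym (path_edges p \<union> {(x, a), (a, x), (y, b), (b, y)})"
        using sym_path_edges[of p] by (auto simp: sym_def)
    qed (use x a b ne in \<open>auto dest: path_edges_in_set\<close>)
  qed
  have "(a, b) \<in> D\<^sup>*"
    using path_edges_connected[OF a(1) D(5)] rtrancl_mono[OF D(3)] by blast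
  then have "(x, y) \<in> D\<^sup>*"
    using D(4,6) by (meson converse_rtrancl_into_rtrancl rtrancl_trans)
  then have "(x, y) \<in> D"
    using bridge D(1,2) xy by blast
  then show ?thesis using D(7) by blast
qed

text \<open>This identifies the off-spine vertices as leaves of the subgraph induced on
  \<open>C\<close>, which links spines to the edge condition of a partition.\<close>

lemma pendant_unique_neighbour:
  assumes "spine E C p" "x \<in> C - set p"
  shows "\<exists>!y. y \<in> C \<and> (x, y) \<in> E"
proof -
  obtain a where a: "a \<in> set p" "(x, a) \<in> E"
    using assms by (auto simp: spine_def)
  show ?thesis
  proof (rule ex1I[of _ a])
    show "a \<in> C \<and> (x, a) \<in> E" using assms a by (auto simp: spine_def)
  qed (use pendant_edges[OF assms _ _ a] in blast)
qed

text \<open>An interior vertex of the path has its predecessor and its successor as two distinct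
  neighbours in \<open>C\<close>.\<close>

lemma unique_neighbour_is_end:
  assumes "link_path E p" "set p \<subseteq> C" "u \<in> set p" "\<exists>!y. y \<in> C \<and> (u, y) \<in> E"
  shows "u \<in> {hd p, last p}"
proof (rule ccontr)
  assume not_end: "u \<notin> {hd p, last p}"
  obtain i where i: "i < length p" "p ! i = u" using assms(3) by (metis in_set_conv_nth)
  have "p ! 0 = hd p" "p ! (length p - 1) = last p"
    using assms(1) by (auto simp: hd_conv_nth last_conv_nth link_path_def)
  then have "i \<noteq> 0" "Suc i \<noteq> length p"
    using i not_end by (metis insert_iff, metis diff_Suc_1 insert_iff)
  then obtain j where j: "i = Suc j" "Suc i < length p"
    using i not0_implies_Suc by fastforce
  have "(p ! j, u) \<in> E" "(u, p ! Suc i) \<in> E"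
    using assms(1) j i by (auto simp: link_path_def)
  moreover have "p ! j \<in> C" "p ! Suc i \<in> C" "p ! j \<noteq> p ! Suc i"
    using assms(1,2) j by (auto simp: link_path_def nth_eq_iff_index_eq)
  ultimately show False
    using assms(4) edge_sym by blast
qed

lemma spine_Cons:
  assumes "spine E C p" "y \<in> C" "y \<notin> set p" "(y, hd p) \<in> E"
  shows "spine E C (y # p)"
proof -
  have "link_path E ([y] @ p)"
    by (rule link_path_append) (use assms in \<open>auto simp: spine_def\<close>)
  with assms show ?thesis by (auto simp: spine_def)
qed

lemma spine_rev: "spine E C p \<Longrightarrow> spine E C (rev p)"
  by (simp add: spine_def link_path_rev')

section \<open>Bounding path lengths by vertices of degree at least 2 within a part\<close>

definition branching :: "'a set \<Rightarrow> 'a set" where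
  "branching C = {x \<in> C. \<exists>y z. y \<in> C \<and> z \<in> C \<and> y \<noteq> z \<and> (x, y) \<in> E \<and> (x, z) \<in> E}"

text \<open>Each inner vertex of \<open>q\<close> has its two path neighbours in \<open>C\<close>;
  only the two ends can fail to be branching.\<close>

lemma card_branching_ge:
  assumes "finite C" "link_path E q" "set q \<subseteq> C"
  shows "length q \<le> card (branching C) + 2"
proof -
  let ?I = "set (butlast (tl q))"
  have "?I \<subseteq> branching C"
  proof
    fix u assume "u \<in> ?I"
    then obtain i where i: "i < length q - 2" "u = butlast (tl q) ! i"
      by (metis diff_diff_left in_set_conv_nth length_butlast length_tl one_add_one)
    then have u: "u = q ! Suc i" by (simp add: nth_butlast nth_tl)
    have "(q ! i, u) \<in> E" "(u, q ! Suc (Suc i)) \<in> E"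
      using assms(2) u i(1) by (auto simp: link_path_def)
    moreover have "q ! i \<noteq> q ! Suc (Suc i)" "q ! i \<in> C" "q ! Suc (Suc i) \<in> C" "u \<in> C"
      using assms(2,3) i(1) u by (auto simp: link_path_def nth_eq_iff_index_eq)
    ultimately show "u \<in> branching C"
      unfolding branching_def using edge_sym by blast
  qed
  moreover have "distinct (butlast (tl q))"
    using assms(2) by (simp add: link_path_def distinct_butlast distinct_tl)
  moreover have "finite (branching C)"
    using assms(1) by (simp add: branching_def)
  ultimately have "length (butlast (tl q)) \<le> card (branching C)"
    by (metis card_mono distinct_card)
  then show ?thesis by simp
qed

text \<open>By maximality every neighbour of \<open>hd p\<close> in \<open>C\<close> lies on
  \<open>p\<close>, since otherwise it could be prepended. Paths in a forest have no chords, so such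
  a neighbour can only be the second vertex.\<close>

lemma maximal_spine_hd:
  assumes sp: "spine E C p" and max: "\<And>q. spine E C q \<Longrightarrow> length q \<le> length p"
  shows "hd p \<notin> branching C"
proof
  assume "hd p \<in> branching C"
  then obtain y z where yz: "y \<in> C" "z \<in> C" "y \<noteq> z" "(hd p, y) \<in> E" "(hd p, z) \<in> E"
    by (auto simp: branching_def)
  have lp: "link_path E p" "set p \<subseteq> C" using sp by (auto simp: spine_def)
  have nb: "w \<in> set p" if "w \<in> C" "(hd p, w) \<in> E" for w
    using spine_Cons[OF sp that(1)] max that(2) edge_sym by force
  have second: "w = p ! 1" if "w \<in> C" "(hd p, w) \<in> E" for w
  proof -
    have "(hd p, w) \<in> path_edges p"
      using edge_in_path[OF lp(1) _ nb[OF that] that(2)] lp by (auto simp: link_path_def)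
    then show ?thesis
      using path_edges_nth[of p 0 w] lp by (auto simp: link_path_def hd_conv_nth)
  qed
  show False using second yz by metis
qed

text \<open>A spine that cannot be extended has two leaves as its ends and contains every branching
  vertex, which is the most that any path can achieve.\<close>

lemma spine_imp_longest_spine:
  assumes fin: "finite C" and "spine E C p\<^sub>0"
  obtains p where "spine E C p" "\<And>q. \<lbrakk>link_path E q; set q \<subseteq> C\<rbrakk> \<Longrightarrow> length q \<le> length p"
proof -
  have bound: "length q \<le> card C" if "spine E C q" for q
    using that fin by (metis spine_def link_path_def card_mono distinct_card)
  obtain p where p: "spine E C p" "\<And>q. spine E C q \<Longrightarrow> length q \<le> length p"
    using ex_has_greatest_nat[of "spine E C" p\<^sub>0 length "Suc (card C)"] assms(2) bound by (auto simp: less_Suc_eq_le)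
  have lp: "link_path E p" "set p \<subseteq> C" "p \<noteq> []" "distinct p"
    using p(1) by (auto simp: spine_def link_path_def)
  have "hd (rev p) \<notin> branching C"
    by (rule maximal_spine_hd) (use p spine_rev in auto)
  then have ends: "hd p \<notin> branching C" "last p \<notin> branching C"
    using maximal_spine_hd[OF p] by (auto simp: hd_rev)
  have "branching C \<subseteq> set p"
    using pendant_unique_neighbour[OF p(1)] unfolding branching_def by blast
  with ends have sub: "branching C \<subseteq> set p - {hd p, last p}" by blast
  have "length q \<le> length p" if q: "link_path E q" "set q \<subseteq> C" for q
  \<comment> \<open>The ends of a one-vertex spine coincide, so removing them would not subtract 2;
    here maximality forces \<open>C\<close> to be that single vertex.\<close>
  proof (cases "length p = 1")
    case True
    then obtain a where a: "p = [a]" by (metis length_0_conv length_Suc_conv One_nat_def)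
    have "C \<subseteq> {a}"
    proof
      fix x assume x: "x \<in> C"
      show "x \<in> {a}"
      proof (rule ccontr)
        assume "x \<notin> {a}"
        then have "(x, hd p) \<in> E" "x \<notin> set p" using p(1) x a by (auto simp: spine_def)
        from p(2)[OF spine_Cons[OF p(1) x this(2,1)]] show False by simp
      qed
    qed
    with q have "card (set q) \<le> card {a}" by (intro card_mono) auto
    with q a show ?thesis by (simp add: link_path_def distinct_card)
  next
    case False
    then have two: "2 \<le> length p" using lp(3) by (cases p; cases "tl p") auto
    then have "hd p \<noteq> last p"
      using lp by (simp add: hd_conv_nth last_conv_nth nth_eq_iff_index_eq)
    then have "card (set p - {hd p, last p}) = length p - 2"
      using lp by (subst card_Diff_subset) (auto simp: distinct_card)
    with card_mono[OF _ sub] have "card (branching C) \<le> length p - 2" by simp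
    with card_branching_ge[OF fin q] two show ?thesis by linarith
  qed
  with p(1) that show thesis by blast
qed

end

section \<open>From caterpillar partitions to legal sequences\<close>

text \<open>A legal sequence with its witnesses made explicit, since both directions work with the
  pairs \<open>vs ! i\<close>, \<open>f i\<close>.\<close>

definition footprints :: "('a \<times> 'a) set \<Rightarrow> 'a list \<Rightarrow> (nat \<Rightarrow> 'a) \<Rightarrow> bool" where
  "footprints E vs f \<longleftrightarrow> (\<forall>i<length vs. (f i = vs ! i \<or> (vs ! i, f i) \<in> E) \<and>
    (\<forall>j<i. f i \<noteq> vs ! j \<and> (vs ! j, f i) \<notin> E))"

text \<open>Conditions (1) and (2) phrased by edges alone: a spine stands for being a caterpillar,
  and the unique-neighbour formula says that a vertex is a leaf of its part.\<close>

definition spine_partition :: "('a \<times> 'a) set \<Rightarrow> 'a set set \<Rightarrow> bool" where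
  "spine_partition E Q \<longleftrightarrow> partition_on (Domain E) Q \<and> (\<forall>C\<in>Q. \<exists>p. spine E C p) \<and>
    (\<forall>C\<in>Q. \<forall>D\<in>Q. C \<noteq> D \<longrightarrow> (\<forall>u\<in>C. \<forall>v\<in>D. (u, v) \<in> E \<longrightarrow>
      \<not> ((\<exists>!y. y \<in> C \<and> (u, y) \<in> E) \<and> (\<exists>!y. y \<in> D \<and> (v, y) \<in> E))))"

section \<open>Orderings under precedence constraints\<close>

lemma topological_sort:
  assumes "finite S" "acyclic R"
  shows "\<exists>xs. distinct xs \<and> set xs = S \<and> (\<forall>j<length xs. \<forall>i<j. (xs ! j, xs ! i) \<notin> R)"
  using assms(1)
proof (induction "card S" arbitrary: S)
  case 0
  then show ?case by (intro exI[of _ "[]"]) simp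
next
  case (Suc n)
  let ?R = "R \<inter> S \<times> S"
  have "finite ?R" using Suc.prems by (simp add: finite_subset[of ?R "S \<times> S"])
  moreover have "acyclic ?R" using assms(2) by (rule acyclic_subset) simp
  ultimately have wf: "wf ?R" by (rule finite_acyclic_wf)
  obtain x where "x \<in> S" using Suc.hyps(2) by (metis card_eq_SucD insertI1)
  then obtain m where m: "m \<in> S" "\<And>y. (y, m) \<in> ?R \<Longrightarrow> y \<notin> S"
    using wfE_min[OF wf] by blast
  have "n = card (S - {m})" using Suc.hyps(2) m(1) by simp
  then obtain xs where xs: "distinct xs" "set xs = S - {m}" "\<And>i j. j < length xs \<Longrightarrow> i < j \<Longrightarrow> (xs ! j, xs ! i) \<notin> R"
    using Suc.hyps(1)[of "S - {m}"] Suc.prems by (metis finite_Diff)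
  show ?case
  proof (intro exI[of _ "m # xs"] conjI allI impI)
    show "distinct (m # xs)" "set (m # xs) = S" using xs m(1) by auto
    fix j i assume j: "j < length (m # xs)" "i < j"
    then obtain j' where j': "j = Suc j'" "j' < length xs" by (cases j) auto
    then have mem: "xs ! j' \<in> S" using xs(2) nth_mem by blast
    show "((m # xs) ! j, (m # xs) ! i) \<notin> R"
    proof (cases i)
      case 0
      have "(xs ! j', m) \<notin> R" using m(2)[of "xs ! j'"] mem m(1) by blast
      with 0 j' show ?thesis by simp
    next
      case (Suc i')
      with j j' xs(3) show ?thesis by simp
    qed
  qed
qed

text \<open>A pair \<open>(w, v)\<close> in this relation forces \<open>w\<close> to precede \<open>v\<close> in a sequence of the vertices of
  \<open>S\<close> in which every \<open>w\<close> newly dominates \<open>f w\<close>.\<close>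

definition precedence :: "'a set \<Rightarrow> ('a \<Rightarrow> 'a) \<Rightarrow> ('a \<times> 'a) set \<Rightarrow> ('a \<times> 'a) set" where
  "precedence S f D = {(w, v). w \<in> S \<and> v \<in> S \<and> w \<noteq> v \<and> (f w = v \<or> (v, f w) \<in> D)}"

context forest_rel
begin

text \<open>Every old constraint stays inside a component of \<open>D\<close>, and the bridge joins
  two components. A new cycle must therefore use a new constraint from the side of \<open>u\<close>
  to \<open>v\<close> and one from the side of \<open>v\<close> to \<open>u\<close>.\<close>

lemma acyclic_precedence_insert:
  assumes D: "D \<subseteq> E" "sym D" and uv: "(u, v) \<in> E" "(u, v) \<notin> D"
    and ac: "acyclic (precedence S f D)"
    and f: "\<And>w. w \<in> S \<Longrightarrow> f w = w \<or> (w, f w) \<in> D"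
    and nofix: "\<not> (u \<in> S \<and> v \<in> S \<and> f u = u \<and> f v = v)"
  shows "acyclic (precedence S f (D \<union> {(u, v), (v, u)}))"
proof -
  let ?c = "precedence S f D"
  have D_sym: "(y, x) \<in> D" if "(x, y) \<in> D" for x y
    using D(2) that by (auto dest: symD)
  have symDs: "(y, x) \<in> D\<^sup>*" if "(x, y) \<in> D\<^sup>*" for x y
    using sym_rtrancl[OF D(2)] that by (auto dest: symD)
  have f_star: "(w, f w) \<in> D\<^sup>*" if "w \<in> S" for w
    using f[OF that] by auto
  have "?c \<subseteq> D\<^sup>*"
  proof
    fix e assume "e \<in> ?c"
    then obtain w x where e: "e = (w, x)" "w \<in> S" "f w = x \<or> (x, f w) \<in> D"
      by (auto simp: precedence_def)
    then show "e \<in> D\<^sup>*" using f_star[of w] D_sym rtrancl.rtrancl_into_rtrancl[of w "f w" D x] by auto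
  qed
  then have c_star: "(x, y) \<in> D\<^sup>*" if "(x, y) \<in> ?c\<^sup>*" for x y
    using rtrancl_subset_rtrancl that by blast
  have sep: "(u, v) \<notin> D\<^sup>*" "(v, u) \<notin> D\<^sup>*"
    using bridge[OF D uv(1)] uv(2) symDs by blast+
  have no_cycle: False if "(x, y) \<in> ?c" "(y, x) \<in> ?c\<^sup>*" for x y
    using ac that unfolding acyclic_def by (meson rtrancl_into_trancl2)
  \<comment> \<open>Two vertices of \<open>S\<close> with a common footprint would each have to
    precede the other. So at most one footprints \<open>u\<close> and at most one footprints
    \<open>v\<close>, and at most two constraints are new.\<close>
  have inj: "w = w'" if "w \<in> S" "w' \<in> S" "f w = f w'" for w w'
  proof (rule ccontr)
    assume "w \<noteq> w'"
    then have "(w, w') \<in> ?c" "(w', w) \<in> ?c"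
      using that f[of w] f[of w'] by (auto simp: precedence_def)
    then show False using no_cycle by blast
  qed
  have new: "precedence S f (D \<union> {(u, v), (v, u)}) \<subseteq>
      ?c \<union> {(w, v) | w. w \<in> S \<and> v \<in> S \<and> f w = u} \<union> {(z, u) | z. z \<in> S \<and> u \<in> S \<and> f z = v}"
    by (auto simp: precedence_def)
  have first: "(v, w) \<notin> ?c\<^sup>*" if "w \<in> S" "f w = u" for w
    using sep(2) c_star f_star[OF that(1)] that(2) rtrancl_trans by metis
  have second: "(u, z) \<notin> ?c\<^sup>*" if "z \<in> S" "f z = v" for z
    using sep(1) c_star f_star[OF that(1)] that(2) rtrancl_trans by metis
  consider (none) "\<not> (v \<in> S \<and> (\<exists>w\<in>S. f w = u))" "\<not> (u \<in> S \<and> (\<exists>z\<in>S. f z = v))"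
    | (left) w where "w \<in> S" "f w = u" "v \<in> S" "\<not> (u \<in> S \<and> (\<exists>z\<in>S. f z = v))"
    | (right) z where "z \<in> S" "f z = v" "u \<in> S" "\<not> (v \<in> S \<and> (\<exists>w\<in>S. f w = u))"
    | (both) w z where "w \<in> S" "f w = u" "v \<in> S" "z \<in> S" "f z = v" "u \<in> S"
    by blast
  then show ?thesis
  proof cases
    case none
    then have "precedence S f (D \<union> {(u, v), (v, u)}) \<subseteq> ?c" using new by blast
    with ac show ?thesis using acyclic_subset by blast
  next
    case left
    then have "precedence S f (D \<union> {(u, v), (v, u)}) \<subseteq> insert (w, v) ?c"
      using new inj by blast
    moreover have "acyclic (insert (w, v) ?c)"
      using ac first[OF left(1,2)] by (simp add: acyclic_insert)
    ultimately show ?thesis using acyclic_subset by blast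
  next
    case right
    then have "precedence S f (D \<union> {(u, v), (v, u)}) \<subseteq> insert (z, u) ?c"
      using new inj by blast
    moreover have "acyclic (insert (z, u) ?c)"
      using ac second[OF right(1,2)] by (simp add: acyclic_insert)
    ultimately show ?thesis using acyclic_subset by blast
  next
    case both
    then have sub: "precedence S f (D \<union> {(u, v), (v, u)}) \<subseteq> insert (z, u) (insert (w, v) ?c)"
      using new inj by blast
    \<comment> \<open>A cycle would run from \<open>u\<close> to \<open>w\<close>, \<open>v\<close>,
      \<open>z\<close> and back to \<open>u\<close>. If \<open>w\<close> differed from
      \<open>u\<close>, the old constraint \<open>(w, u)\<close> would already close a cycle; hence
      \<open>w\<close> is \<open>u\<close>, likewise \<open>z\<close> is \<open>v\<close>, and both
      ends of the new edge footprint themselves.\<close>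
    have "\<not> ((u, w) \<in> ?c\<^sup>* \<and> (v, z) \<in> ?c\<^sup>*)"
    proof
      assume cyc: "(u, w) \<in> ?c\<^sup>* \<and> (v, z) \<in> ?c\<^sup>*"
      have "w = u"
        using no_cycle[of w u] cyc both by (auto simp: precedence_def)
      moreover have "z = v"
        using no_cycle[of z v] cyc both by (auto simp: precedence_def)
      ultimately show False using both nofix by simp
    qed
    then have "(u, z) \<notin> (insert (w, v) ?c)\<^sup>*"
      using second[OF both(4,5)] by (simp add: rtrancl_insert)
    then have "acyclic (insert (z, u) (insert (w, v) ?c))"
      using ac first[OF both(1,2)] by (simp add: acyclic_insert)
    with sub show ?thesis using acyclic_subset by blast
  qed
qed

text \<open>The edges outside \<open>D\<close> are added one at a time, each with its reverse, while
  \<open>f\<close> stays fixed.\<close>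

lemma acyclic_precedence_extend:
  assumes fin: "finite E"
    and "D \<subseteq> E" "sym D" "acyclic (precedence S f D)"
    and "\<And>w. w \<in> S \<Longrightarrow> f w = w \<or> (w, f w) \<in> D"
    and "\<And>u v. (u, v) \<in> E - D \<Longrightarrow> \<not> (u \<in> S \<and> v \<in> S \<and> f u = u \<and> f v = v)"
  shows "acyclic (precedence S f E)"
  using assms(2-)
proof (induction "card (E - D)" arbitrary: D rule: less_induct)
  case less
  show ?case
  proof (cases "D = E")
    case False
    then obtain u v where uv: "(u, v) \<in> E" "(u, v) \<notin> D" using less.prems(1) by auto
    let ?D = "D \<union> {(u, v), (v, u)}"
    have "E - ?D \<subset> E - D" using uv by blast
    then have "card (E - ?D) < card (E - D)" using fin by (simp add: psubset_card_mono)
    moreover have "acyclic (precedence S f ?D)"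
      by (rule acyclic_precedence_insert[OF less.prems(1,2) uv less.prems(3,4)])
        (use uv less.prems(5) in auto)
    moreover have "?D \<subseteq> E" "sym ?D"
      using less.prems(1,2) uv edge_sym by (auto simp: sym_def)
    ultimately show ?thesis
      using less.prems(4,5) by (intro less.hyps[of ?D]) auto
  qed (use less in simp)
qed

text \<open>\<open>S\<close> omits one vertex per part, the last of its spine. Constraints are first
  checked on \<open>D\<close>, the spines with their pendant edges, by a rank; the edges between
  parts then enter through \<open>acyclic_precedence_extend\<close>.\<close>

theorem spine_partition_imp_footprints:
  assumes fin: "finite V" and EV: "E \<subseteq> V \<times> V" and Q: "spine_partition E Q"
  obtains vs f where "set vs \<subseteq> V" "footprints E vs f" "length vs + card Q = card V"
proof -
  have part: "partition_on (Domain E) Q" using Q by (simp add: spine_partition_def)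
  have QV: "C \<subseteq> V" if "C \<in> Q" for C
    using partition_onD1[OF part] that EV by auto
  have uniq: "C = D" if "C \<in> Q" "D \<in> Q" "x \<in> C" "x \<in> D" for C D x
    using partition_onD2[OF part] that by (auto simp: disjoint_def)
  have "\<exists>sp. \<forall>C\<in>Q. spine E C (sp C)"
    using Q by (intro bchoice) (auto simp: spine_partition_def)
  then obtain sp where sp: "\<And>C. C \<in> Q \<Longrightarrow> spine E C (sp C)" by blast
  have lp: "link_path E (sp C)" "set (sp C) \<subseteq> C" "distinct (sp C)" "sp C \<noteq> []" if "C \<in> Q" for C
    using sp[OF that] by (auto simp: spine_def link_path_def)
  define U where "U = (\<Union>C\<in>Q. set (sp C))"
  have "\<forall>x\<in>U. \<exists>ck. fst ck \<in> Q \<and> snd ck < length (sp (fst ck)) \<and> sp (fst ck) ! snd ck = x"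
    by (auto simp: U_def in_set_conv_nth)
  then obtain ck where ck:
    "\<And>x. x \<in> U \<Longrightarrow> fst (ck x) \<in> Q \<and> snd (ck x) < length (sp (fst (ck x))) \<and> sp (fst (ck x)) ! snd (ck x) = x"
    by metis
  \<comment> \<open>\<open>c x\<close> and \<open>k x\<close> locate a spine vertex: its part and
    its position on the spine of that part.\<close>
  define c where "c x = fst (ck x)" for x
  define k where "k x = snd (ck x)" for x
  have ckU: "c x \<in> Q" "k x < length (sp (c x))" "sp (c x) ! k x = x" if "x \<in> U" for x
    using ck[OF that] by (auto simp: c_def k_def)
  have locU: "sp C ! i \<in> U" if "C \<in> Q" "i < length (sp C)" for C i
    using that nth_mem by (fastforce simp: U_def)
  have loc: "c (sp C ! i) = C" "k (sp C ! i) = i" if C: "C \<in> Q" "i < length (sp C)" for C i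
  proof -
    let ?x = "sp C ! i"
    note x = ckU[OF locU[OF C]]
    have "?x \<in> C" "?x \<in> c ?x"
      using lp(2)[OF C(1)] C(2) lp(2)[OF x(1)] x(2,3) nth_mem by (blast, metis subsetD)
    then show c: "c ?x = C" using uniq x(1) C(1) by blast
    show "k ?x = i"
      using x(2,3) C lp(3) unfolding c by (simp add: nth_eq_iff_index_eq)
  qed
  have "\<forall>x\<in>Domain E - U. \<exists>y. (x, y) \<in> E \<and> (\<exists>C\<in>Q. x \<in> C \<and> y \<in> set (sp C))"
  proof
    fix x assume x: "x \<in> Domain E - U"
    then obtain C where C: "C \<in> Q" "x \<in> C" using partition_onD1[OF part] by auto
    with x have "x \<in> C - set (sp C)" by (auto simp: U_def)
    with sp[OF C(1)] C show "\<exists>y. (x, y) \<in> E \<and> (\<exists>C\<in>Q. x \<in> C \<and> y \<in> set (sp C))"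
      unfolding spine_def by blast
  qed
  then obtain a where a: "\<And>x. x \<in> Domain E - U \<Longrightarrow> (x, a x) \<in> E \<and> (\<exists>C\<in>Q. x \<in> C \<and> a x \<in> set (sp C))"
    by metis
  have aU: "a x \<in> U" if "x \<in> Domain E - U" for x
    using a[OF that] by (auto simp: U_def)
  \<comment> \<open>At the last vertex of a spine the index runs past the end and the value is
    unspecified; \<open>S\<close> excludes exactly these vertices.\<close>
  define f where "f x = (if x \<in> U then sp (c x) ! Suc (k x) else x)" for x
  define S where "S = V - (\<lambda>C. last (sp C)) ` Q"
  define D where "D = (\<Union>C\<in>Q. path_edges (sp C)) \<union> {(x, a x) | x. x \<in> Domain E - U} \<union>
    {(a x, x) | x. x \<in> Domain E - U}"
  \<comment> \<open>A pendant vertex precedes the spine vertex it hangs on, hence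
    \<open>2 * k\<close> against \<open>2 * k + 1\<close>. A spine vertex at position
    \<open>i\<close> footprints position \<open>i + 1\<close>, so it precedes the vertices at
    positions \<open>i + 1\<close> and \<open>i + 2\<close> and the pendants at
    \<open>i + 1\<close>, of ranks \<open>2 * i + 3\<close>, \<open>2 * i + 5\<close> and
    \<open>2 * i + 2\<close>.\<close>
  define rank where "rank x = (if x \<in> U then 2 * k x + 1 else 2 * k (a x))" for x
  have SU: "Suc (k x) < length (sp (c x))" if "x \<in> S" "x \<in> U" for x
  proof (rule ccontr)
    assume "\<not> ?thesis"
    with ckU[OF that(2)] have "Suc (k x) = length (sp (c x))" by simp
    then have "k x = length (sp (c x)) - 1" by simp
    then have "x = last (sp (c x))"
      using ckU[OF that(2)] lp(4) by (simp add: last_conv_nth)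
    with that(1) ckU(1)[OF that(2)] show False by (auto simp: S_def)
  qed
  have DE: "D \<subseteq> E"
    using path_edges_subset[OF sym_E lp(1)] a edge_sym by (fastforce simp: D_def)
  have sD: "sym D"
    using sym_path_edges by (fastforce simp: D_def sym_def)
  have fD: "f w = w \<or> (w, f w) \<in> D" if "w \<in> S" for w
  proof (cases "w \<in> U")
    case True
    have "(sp (c w) ! k w, sp (c w) ! Suc (k w)) \<in> path_edges (sp (c w))"
      using SU[OF that True] by (auto simp: path_edges_def)
    then show ?thesis using True ckU[OF True] by (auto simp: f_def D_def)
  qed (simp add: f_def)
  have "rank w < rank v" if "(w, v) \<in> precedence S f D" for w v
  proof -
    have wv: "w \<in> S" "v \<in> S" "w \<noteq> v" "f w = v \<or> (v, f w) \<in> D"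
      using that by (auto simp: precedence_def)
    show ?thesis
    proof (cases "w \<in> U")
      case False
      then have "f w = w" by (simp add: f_def)
      with wv have "(v, w) \<in> D" by auto
      then consider C where "C \<in> Q" "(v, w) \<in> path_edges (sp C)" | "v \<in> Domain E - U" "w = a v"
        | "w \<in> Domain E - U" "v = a w"
        unfolding D_def by blast
      then have "w \<in> Domain E - U \<and> v = a w"
      proof cases
        case 1
        then have "w \<in> U" using path_edges_in_set unfolding U_def by fast
        with False show ?thesis by blast
      next
        case 2
        with False aU show ?thesis by blast
      qed blast
      then show ?thesis using False aU by (simp add: rank_def)
    next
      case True
      let ?C = "c w" and ?i = "k w"
      note C = ckU[OF True] and i = SU[OF wv(1) True]
      have fw: "f w = sp ?C ! Suc ?i" using True by (simp add: f_def)
      have fwU: "f w \<in> U" and kf: "k (f w) = Suc ?i"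
        using locU[OF C(1) i] loc(2)[OF C(1) i] fw by auto
      have rf: "rank (f w) = 2 * ?i + 3" "rank w = 2 * ?i + 1"
        using fwU kf True by (auto simp: rank_def)
      from wv(4) consider "f w = v" | C' where "C' \<in> Q" "(v, f w) \<in> path_edges (sp C')"
        | "v \<in> Domain E - U" "f w = a v"
        using fwU unfolding D_def by blast
      then show ?thesis
      proof cases
        case 1 with rf show ?thesis by auto
      next
        case 2
        from 2(2) have "f w \<in> set (sp C')" by (auto dest: path_edges_in_set)
        moreover have "f w \<in> ?C" using fw i lp(2)[OF C(1)] by auto
        ultimately have C': "C' = ?C" using uniq[OF 2(1) C(1)] lp(2)[OF 2(1)] by blast
        have "(f w, v) \<in> path_edges (sp ?C)"
          using 2(2) C' symD[OF sym_path_edges] by metis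
        then have "(Suc (Suc ?i) < length (sp ?C) \<and> v = sp ?C ! Suc (Suc ?i)) \<or> v = sp ?C ! ?i"
          using path_edges_nth[OF lp(3)[OF C(1)] i, of v] fw by auto
        with C(3) wv(3) have v: "Suc (Suc ?i) < length (sp ?C)" "v = sp ?C ! Suc (Suc ?i)" by auto
        then have "v \<in> U" "k v = Suc (Suc ?i)"
          using locU[OF C(1)] loc(2)[OF C(1)] by auto
        with rf show ?thesis by (simp add: rank_def)
      next
        case 3
        then have "rank v = 2 * Suc ?i" using kf by (simp add: rank_def)
        with rf show ?thesis by simp
      qed
    qed
  qed
  then have "precedence S f D \<subseteq> measure rank" by auto
  then have acD: "acyclic (precedence S f D)"
    using wf_acyclic[OF wf_measure] acyclic_subset by blast
  \<comment> \<open>\<open>D\<close> already connects each part, and every edge is a bridge, so no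
    edge inside a part is missing from \<open>D\<close>.\<close>
  have same_part: "(x, y) \<in> D" if "(x, y) \<in> E" "C \<in> Q" "x \<in> C" "y \<in> C" for x y C
  proof -
    have to_spine: "\<exists>z\<in>set (sp C). (x, z) \<in> D\<^sup>* \<and> (z, x) \<in> D\<^sup>*" if "x \<in> C" for x
    proof (cases "x \<in> set (sp C)")
      case False
      have x: "x \<in> Domain E - U"
      proof -
        have "x \<notin> set (sp C')" if "C' \<in> Q" for C'
          using False lp(2)[OF that] uniq[OF \<open>C \<in> Q\<close> that \<open>x \<in> C\<close>] by blast
        moreover have "x \<in> Domain E"
          using partition_onD1[OF part] \<open>C \<in> Q\<close> \<open>x \<in> C\<close> by auto
        ultimately show ?thesis by (auto simp: U_def)
      qed
      then have "(x, a x) \<in> D" "(a x, x) \<in> D" by (auto simp: D_def)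
      moreover have "a x \<in> set (sp C)"
        using a[OF x] uniq \<open>C \<in> Q\<close> \<open>x \<in> C\<close> by blast
      ultimately show ?thesis by blast
    qed auto
    obtain z where z: "z \<in> set (sp C)" "(x, z) \<in> D\<^sup>*" using to_spine \<open>x \<in> C\<close> by blast
    obtain z' where z': "z' \<in> set (sp C)" "(z', y) \<in> D\<^sup>*" using to_spine \<open>y \<in> C\<close> by blast
    have "path_edges (sp C) \<subseteq> D" using \<open>C \<in> Q\<close> by (auto simp: D_def)
    then have "(z, z') \<in> D\<^sup>*"
      using path_edges_connected[OF z(1) z'(1)] rtrancl_mono by blast
    with z z' have "(x, y) \<in> D\<^sup>*" by (meson rtrancl_trans)
    with bridge[OF DE sD] that(1) show ?thesis by blast
  qed
  \<comment> \<open>Self-footprinting vertices of \<open>S\<close> lie off all spines, because a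
    spine vertex differs from its successor, so those in a part are leaves of it. An edge outside
    \<open>D\<close> joins different parts, where two leaves must not be adjacent.\<close>
  have loops: "\<not> (u \<in> S \<and> v \<in> S \<and> f u = u \<and> f v = v)" if "(u, v) \<in> E - D" for u v
  proof
    assume uv: "u \<in> S \<and> v \<in> S \<and> f u = u \<and> f v = v"
    have "u \<in> Domain E" "v \<in> Domain E" using that edge_sym by auto
    then obtain C C' where C: "C \<in> Q" "u \<in> C" "C' \<in> Q" "v \<in> C'"
      using partition_onD1[OF part] by auto
    have ne: "C \<noteq> C'" using same_part that C by blast
    have pend: "\<exists>!y. y \<in> C \<and> (x, y) \<in> E" if "x \<in> S" "f x = x" "C \<in> Q" "x \<in> C" for x C
    proof -
      have "x \<notin> U"
      proof
        assume x: "x \<in> U"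
        then have "sp (c x) ! Suc (k x) = sp (c x) ! k x"
          using that(2) ckU(3) by (simp add: f_def)
        with SU[OF that(1) x] lp(3)[OF ckU(1)[OF x]] show False
          by (simp add: nth_eq_iff_index_eq)
      qed
      then have "x \<notin> set (sp C)" using that(3) by (auto simp: U_def)
      then show ?thesis using pendant_unique_neighbour[OF sp[OF that(3)]] that(4) by blast
    qed
    show False
      using Q C ne pend[OF _ _ C(1,2)] pend[OF _ _ C(3,4)] uv that by (auto simp: spine_partition_def)
  qed
  have finE: "finite E" using fin EV by (meson finite_SigmaI finite_subset)
  have "acyclic (precedence S f E)"
    by (rule acyclic_precedence_extend[OF finE DE sD acD fD loops])
  moreover have "finite S" using fin by (simp add: S_def)
  ultimately obtain vs where vs: "distinct vs" "set vs = S"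
    "\<And>i j. j < length vs \<Longrightarrow> i < j \<Longrightarrow> (vs ! j, vs ! i) \<notin> precedence S f E"
    using topological_sort by metis
  \<comment> \<open>The sorting leaves no constraint from a later entry to an earlier one, which is
    exactly the freshness of footprints.\<close>
  have "footprints E vs (\<lambda>i. f (vs ! i))"
    unfolding footprints_def
  proof (intro allI impI conjI)
    fix i assume i: "i < length vs"
    then have Si: "vs ! i \<in> S" using vs(2) nth_mem by blast
    then show "f (vs ! i) = vs ! i \<or> (vs ! i, f (vs ! i)) \<in> E" using fD DE by blast
    fix j assume j: "j < i"
    then have "vs ! j \<in> S" "vs ! j \<noteq> vs ! i"
      using vs(1,2) i nth_mem[of j vs] by (auto simp: nth_eq_iff_index_eq)
    with Si vs(3)[OF i j] show "f (vs ! i) \<noteq> vs ! j" "(vs ! j, f (vs ! i)) \<notin> E"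
      by (auto simp: precedence_def)
  qed
  moreover have "length vs + card Q = card V"
  proof -
    have lastC: "last (sp C) \<in> C" if "C \<in> Q" for C
      using lp(2,4)[OF that] last_in_set by blast
    \<comment> \<open>The parts are disjoint, so their spine ends are distinct and \<open>S\<close>
      misses exactly \<open>card Q\<close> vertices.\<close>
    then have "inj_on (\<lambda>C. last (sp C)) Q"
      using uniq by (intro inj_onI) metis
    then have "card ((\<lambda>C. last (sp C)) ` Q) = card Q" by (rule card_image)
    moreover have sub: "(\<lambda>C. last (sp C)) ` Q \<subseteq> V" using lastC QV by blast
    moreover have "length vs = card S" using vs(1,2) distinct_card by fastforce
    ultimately show ?thesis
      using fin card_mono[OF fin sub] by (simp add: S_def card_Diff_subset finite_subset)
  qed
  moreover have "set vs \<subseteq> V" using vs(2) by (auto simp: S_def)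
  ultimately show thesis using that by blast
qed

end

section \<open>From legal sequences to caterpillar partitions\<close>

context forest_rel
begin

section \<open>Families of disjoint paths\<close>

definition path_family :: "'a list set \<Rightarrow> bool" where
  "path_family \<S> \<longleftrightarrow> finite \<S> \<and> (\<forall>p\<in>\<S>. link_path E p) \<and>
    (\<forall>p\<in>\<S>. \<forall>q\<in>\<S>. p \<noteq> q \<longrightarrow> set p \<inter> set q = {})"

lemma path_family_join:
  assumes "path_family \<S>" "p \<in> \<S>" "q \<in> \<S>" "p \<noteq> q"
    and r: "link_path E r" "set r = set p \<union> set q"
  shows "path_family (insert r (\<S> - {p, q}))" "card (insert r (\<S> - {p, q})) = card \<S> - 1"
    "\<Union>(set ` insert r (\<S> - {p, q})) = \<Union>(set ` \<S>)"
proof -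
  have fam: "finite \<S>" "\<And>p. p \<in> \<S> \<Longrightarrow> link_path E p"
    "\<And>p q. p \<in> \<S> \<Longrightarrow> q \<in> \<S> \<Longrightarrow> p \<noteq> q \<Longrightarrow> set p \<inter> set q = {}"
    using assms(1) by (auto simp: path_family_def)
  have disj: "set r \<inter> set s = {}" if "s \<in> \<S> - {p, q}" for s
    using that fam(3)[of p s] fam(3)[of q s] assms(2,3) r(2) by blast
  have "r \<notin> \<S> - {p, q}"
    using disj[of r] r(1) by (auto simp: link_path_def)
  moreover have "card \<S> \<ge> 2"
    using card_mono[OF fam(1), of "{p, q}"] assms(2-4) by auto
  ultimately show "card (insert r (\<S> - {p, q})) = card \<S> - 1"
    using fam(1) assms(2-4) by (simp add: card_Diff_subset)
  show "path_family (insert r (\<S> - {p, q}))"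
    unfolding path_family_def
  proof (intro conjI ballI impI)
    fix x y assume "x \<in> insert r (\<S> - {p, q})" "y \<in> insert r (\<S> - {p, q})" "x \<noteq> y"
    then show "set x \<inter> set y = {}"
      using disj[of x] disj[of y] fam(3)[of x y] by blast
  qed (use fam r in auto)
  show "\<Union>(set ` insert r (\<S> - {p, q})) = \<Union>(set ` \<S>)"
    using r(2) assms(2,3) by auto
qed

lemma path_family_replace:
  assumes "path_family \<S>" "p \<in> \<S>" and u: "u \<notin> \<Union>(set ` \<S>)"
    and r: "link_path E r" "set r = insert u (set p)"
  shows "path_family (insert r (\<S> - {p}))" "card (insert r (\<S> - {p})) = card \<S>"
    "\<Union>(set ` insert r (\<S> - {p})) = insert u (\<Union>(set ` \<S>))"
proof -
  have fam: "finite \<S>" "\<And>p. p \<in> \<S> \<Longrightarrow> link_path E p"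
    "\<And>p q. p \<in> \<S> \<Longrightarrow> q \<in> \<S> \<Longrightarrow> p \<noteq> q \<Longrightarrow> set p \<inter> set q = {}"
    using assms(1) by (auto simp: path_family_def)
  have disj: "set r \<inter> set s = {}" if "s \<in> \<S> - {p}" for s
  proof -
    have "u \<notin> set s" using u that by auto
    moreover have "set p \<inter> set s = {}" using fam(3)[of p s] assms(2) that by auto
    ultimately show ?thesis using r(2) by auto
  qed
  have "r \<notin> \<S> - {p}"
    using disj[of r] r(1) by (auto simp: link_path_def)
  then show "card (insert r (\<S> - {p})) = card \<S>"
    using fam(1) assms(2) by (metis card.remove card_insert_disjoint finite_Diff)
  show "path_family (insert r (\<S> - {p}))"
    unfolding path_family_def
  proof (intro conjI ballI impI)
    fix x y assume "x \<in> insert r (\<S> - {p})" "y \<in> insert r (\<S> - {p})" "x \<noteq> y"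
    then show "set x \<inter> set y = {}"
      using disj[of x] disj[of y] fam(3)[of x y] by blast
  qed (use fam r in auto)
  show "\<Union>(set ` insert r (\<S> - {p})) = insert u (\<Union>(set ` \<S>))"
    using r(2) assms(2) by auto
qed

text \<open>Joining every vertex of the sequence to its footprint produces paths; the vertices that
  footprint themselves drop out of the family.\<close>

lemma footprints_imp_path_family:
  assumes fin: "finite V" and EV: "E \<subseteq> V \<times> V" and vs: "set vs \<subseteq> V" and fp: "footprints E vs f"
  obtains \<S> where "path_family \<S>" "\<Union>(set ` \<S>) \<subseteq> V"
    "V - {vs ! i | i. i < length vs \<and> f i = vs ! i} \<subseteq> \<Union>(set ` \<S>)" "card \<S> + length vs = card V"
proof -
  have f: "f i = vs ! i \<or> (vs ! i, f i) \<in> E" if "i < length vs" for i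
    using fp that by (simp add: footprints_def)
  have fresh: "f i \<noteq> vs ! j" "(vs ! j, f i) \<notin> E" "f i \<noteq> f j" "vs ! i \<noteq> vs ! j"
    if "i < length vs" "j < i" for i j
  proof -
    show ff: "f i \<noteq> vs ! j" "(vs ! j, f i) \<notin> E" using fp that by (auto simp: footprints_def)
    then show "f i \<noteq> f j" "vs ! i \<noteq> vs ! j" using f[of i] f[of j] that by auto
  qed
  \<comment> \<open>Invariant after \<open>n\<close> steps. By the last conjunct each link leads
    from an earlier entry to its footprint; hence the new entry \<open>vs ! n\<close> ends its path
    and the fresh \<open>f n\<close> starts its path.\<close>
  have "\<exists>\<S>. path_family \<S> \<and> \<Union>(set ` \<S>) \<subseteq> V \<and>
      V - {vs ! i | i. i < n \<and> f i = vs ! i} \<subseteq> \<Union>(set ` \<S>) \<and> card \<S> + n = card V \<and>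
      (\<forall>p\<in>\<S>. \<forall>m. Suc m < length p \<longrightarrow> (\<exists>j<n. p ! m = vs ! j \<and> p ! Suc m = f j))"
    if "n \<le> length vs" for n
    using that
  proof (induction n)
    case 0
    have "inj_on (\<lambda>x. [x]) V" by (simp add: inj_on_def)
    \<comment> \<open>Initially every vertex of \<open>V\<close> is a path of its own.\<close>
    then show ?case
      using fin by (intro exI[of _ "(\<lambda>x. [x]) ` V"]) (auto simp: path_family_def card_image)
  next
    case (Suc n)
    then obtain \<S> where fam: "path_family \<S>" and sub: "\<Union>(set ` \<S>) \<subseteq> V"
      and cov: "V - {vs ! i | i. i < n \<and> f i = vs ! i} \<subseteq> \<Union>(set ` \<S>)" and card: "card \<S> + n = card V"
      and step: "\<And>p m. \<lbrakk>p \<in> \<S>; Suc m < length p\<rbrakk> \<Longrightarrow> \<exists>j<n. p ! m = vs ! j \<and> p ! Suc m = f j"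
      by auto
    have n: "n < length vs" using Suc.prems by simp
    let ?x = "vs ! n" and ?y = "f n"
    note fr = fresh[OF n]
    have xV: "?x \<in> V" using vs n nth_mem by blast
    have yV: "?y \<in> V" using f[OF n] xV EV by auto
    \<comment> \<open>Only self-footprinting entries have dropped out, and by freshness neither
      \<open>?x\<close> nor \<open>?y\<close> is an earlier entry.\<close>
    have "?x \<in> \<Union>(set ` \<S>)" using cov xV fr(4) by blast
    then obtain p where p: "p \<in> \<S>" "?x \<in> set p" by blast
    have "?y \<in> \<Union>(set ` \<S>)" using cov yV fr(1) by blast
    then obtain q where q: "q \<in> \<S>" "?y \<in> set q" by blast
    have lp: "link_path E p" "link_path E q" using fam p q by (auto simp: path_family_def)
    have x_last: "?x = last p"
    proof -
      obtain m where m: "m < length p" "p ! m = ?x" using p(2) by (metis in_set_conv_nth)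
      have "\<not> Suc m < length p" using step[OF p(1), of m] m(2) fr(4) by metis
      with m have "m = length p - 1" by simp
      with m lp(1) show ?thesis by (simp add: last_conv_nth link_path_def)
    qed
    have y_hd: "?y = hd q"
    proof -
      obtain m where m: "m < length q" "q ! m = ?y" using q(2) by (metis in_set_conv_nth)
      have "m = 0"
      proof (rule ccontr)
        assume "m \<noteq> 0"
        then obtain l where "m = Suc l" using not0_implies_Suc by blast
        with step[OF q(1), of l] m fr(3) show False by metis
      qed
      with m lp(2) show ?thesis by (simp add: hd_conv_nth link_path_def)
    qed
    have pos: "0 < card \<S>" using p(1) fam by (auto simp: path_family_def card_gt_0_iff)
    show ?case
    proof (cases "?y = ?x")
      case True
      \<comment> \<open>Being both first and last, \<open>?x\<close> is a path by itself; deleting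
        that path uncovers only \<open>?x\<close>.\<close>
      have "q = p" using fam p q True by (auto simp: path_family_def)
      then have "hd p = last p" using x_last y_hd True by simp
      moreover have "p \<noteq> []" "distinct p" using lp(1) by (auto simp: link_path_def)
      ultimately have "p = [?x]"
        using x_last by (cases p) (auto split: if_splits)
      then have un: "\<Union>(set ` (\<S> - {p})) \<supseteq> \<Union>(set ` \<S>) - {?x}" by auto
      show ?thesis
      proof (intro exI[of _ "\<S> - {p}"] conjI)
        show "path_family (\<S> - {p})" using fam by (auto simp: path_family_def)
        show "card (\<S> - {p}) + Suc n = card V"
          using card pos fam p(1) by (simp add: path_family_def)
        have "V - {vs ! i | i. i < Suc n \<and> f i = vs ! i} \<subseteq> (V - {vs ! i | i. i < n \<and> f i = vs ! i}) - {?x}"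
          using True by (auto simp: less_Suc_eq)
        then show "V - {vs ! i | i. i < Suc n \<and> f i = vs ! i} \<subseteq> \<Union>(set ` (\<S> - {p}))"
          using order_trans[OF _ un] cov by (meson Diff_mono order_refl order_trans)
        show "\<Union>(set ` (\<S> - {p})) \<subseteq> V" using sub by blast
        show "\<forall>q\<in>\<S> - {p}. \<forall>m. Suc m < length q \<longrightarrow> (\<exists>j<Suc n. q ! m = vs ! j \<and> q ! Suc m = f j)"
          using step by (meson DiffD1 less_SucI)
      qed
    next
      case False
      then have xy: "(?x, ?y) \<in> E" using f[OF n] by simp
      \<comment> \<open>On a single path the edge would be a chord unless \<open>?x\<close> directly
        follows \<open>?y\<close>. But then \<open>?y\<close> is an earlier entry, against
        freshness.\<close>
      have "p \<noteq> q"
      proof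
        assume pq: "p = q"
        have d: "distinct p" "p \<noteq> []" using lp(1) by (auto simp: link_path_def)
        have "(?y, ?x) \<in> path_edges p"
          using edge_in_path[OF lp(1)] p(2) q(2) pq edge_sym[OF xy] by blast
        then have "(p ! 0, ?x) \<in> path_edges p" using y_hd pq d by (simp add: hd_conv_nth)
        then have "Suc 0 < length p" "?x = p ! Suc 0"
          using path_edges_nth[OF d(1), of 0 ?x] d(2) by auto
        then obtain j where "j < n" "p ! 0 = vs ! j"
          using step[OF p(1), of 0] by auto
        with fr(1)[of j] y_hd pq d show False by (simp add: hd_conv_nth)
      qed
      moreover from this have "set p \<inter> set q = {}" using fam p q by (auto simp: path_family_def)
      moreover from this have "link_path E (p @ q)"
        using link_path_append lp xy x_last y_hd by metis
      ultimately have join: "path_family (insert (p @ q) (\<S> - {p, q}))"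
        "card (insert (p @ q) (\<S> - {p, q})) = card \<S> - 1"
        "\<Union>(set ` insert (p @ q) (\<S> - {p, q})) = \<Union>(set ` \<S>)"
        using path_family_join[OF fam p(1) q(1), of "p @ q"] by auto
      have new: "\<exists>j<Suc n. (p @ q) ! m = vs ! j \<and> (p @ q) ! Suc m = f j" if m: "Suc m < length (p @ q)" for m
      proof -
        consider "Suc m < length p" | "Suc m = length p" | "length p \<le> m" by linarith
        then show ?thesis
        proof cases
          case 1
          with step[OF p(1) 1] show ?thesis by (auto simp: nth_append less_Suc_eq)
        next
          case 2
          then have "m = length p - 1" by simp
          with 2 x_last y_hd lp have "(p @ q) ! m = ?x \<and> (p @ q) ! Suc m = ?y"
            by (simp add: nth_append last_conv_nth hd_conv_nth link_path_def)
          then show ?thesis by blast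
        next
          case 3
          then have "Suc (m - length p) < length q" using m by simp
          from step[OF q(1) this] 3 show ?thesis
            by (auto simp: nth_append less_Suc_eq Suc_diff_le)
        qed
      qed
      show ?thesis
      proof (intro exI[of _ "insert (p @ q) (\<S> - {p, q})"] conjI)
        show "card (insert (p @ q) (\<S> - {p, q})) + Suc n = card V"
          using join(2) card pos by simp
        show "V - {vs ! i | i. i < Suc n \<and> f i = vs ! i} \<subseteq> \<Union>(set ` insert (p @ q) (\<S> - {p, q}))"
          unfolding join(3) using cov by (auto simp: less_Suc_eq)
        show "\<forall>r\<in>insert (p @ q) (\<S> - {p, q}). \<forall>m. Suc m < length r \<longrightarrow>
            (\<exists>j<Suc n. r ! m = vs ! j \<and> r ! Suc m = f j)"
        proof (intro ballI allI impI)
          fix r m assume "r \<in> insert (p @ q) (\<S> - {p, q})" and m: "Suc m < length r"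
          then consider "r = p @ q" | "r \<in> \<S>" by blast
          then show "\<exists>j<Suc n. r ! m = vs ! j \<and> r ! Suc m = f j"
          proof cases
            case 1 then show ?thesis using new[of m] m by simp
          next
            case 2 then show ?thesis using step[OF 2 m] by (meson less_SucI)
          qed
        qed
      qed (use join sub in auto)
    qed
  qed
  from this[of "length vs"] that show thesis by blast
qed

text \<open>Of two adjacent entries the later one is already dominated by the earlier one, so it
  cannot be its own footprint.\<close>

lemma footprints_self_independent:
  assumes "footprints E vs f" "i < length vs" "j < length vs" "f i = vs ! i" "f j = vs ! j"
  shows "(vs ! i, vs ! j) \<notin> E"
proof -
  consider "i = j" | "i < j" | "j < i" by linarith
  then show ?thesis
  proof cases
    case 2 with assms show ?thesis by (metis footprints_def)
  next
    case 3 with assms show ?thesis by (metis footprints_def edge_sym)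
  qed (simp add: irrefl_E)
qed

theorem footprints_imp_spine_partition:
  assumes fin: "finite V" and EV: "E \<subseteq> V \<times> V" and vs: "set vs \<subseteq> V" and fp: "footprints E vs f"
  obtains Q where "spine_partition E Q" "card Q + length vs \<le> card V"
proof -
  define I where "I = {vs ! i | i. i < length vs \<and> f i = vs ! i}"
  have indep: "(x, y) \<notin> E" if "x \<in> I" "y \<in> I" for x y
    using that footprints_self_independent[OF fp] by (auto simp: I_def)
  let ?W = "Domain E"
  have WV: "?W \<subseteq> V" using EV by auto
  have finW: "finite ?W" using fin WV finite_subset by blast
  \<comment> \<open>\<open>good\<close> forgets how the family arose from \<open>vs\<close> and
    keeps what survives joining and extending: disjoint paths, uncovered vertices only in the
    independent set \<open>I\<close>, and the bound on the number of paths.\<close>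
  define good where "good \<S> \<longleftrightarrow> path_family \<S> \<and> \<Union>(set ` \<S>) \<subseteq> ?W \<and> ?W - I \<subseteq> \<Union>(set ` \<S>) \<and>
    card \<S> + length vs \<le> card V" for \<S>
  have "\<exists>\<S>. good \<S>"
  proof -
    obtain \<S> where S: "path_family \<S>" "\<Union>(set ` \<S>) \<subseteq> V" "V - I \<subseteq> \<Union>(set ` \<S>)"
      "card \<S> + length vs = card V"
      using footprints_imp_path_family[OF fin EV vs fp, folded I_def] .
    \<comment> \<open>The discarded paths are single isolated vertices, since every vertex on a
      longer path has a neighbour.\<close>
    let ?T = "{p \<in> \<S>. set p \<subseteq> ?W}"
    have "path_family ?T" using S(1) by (auto simp: path_family_def)
    moreover have "card ?T \<le> card \<S>" using S(1) by (auto simp: path_family_def intro: card_mono)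
    moreover have cov: "x \<in> \<Union>(set ` ?T)" if x: "x \<in> ?W - I" for x
    proof -
      obtain p where p: "p \<in> \<S>" "x \<in> set p" using x S(3) WV by blast
      then have lp: "link_path E p" using S(1) by (auto simp: path_family_def)
      have "y \<in> ?W" if "y \<in> set p" for y
      proof (cases "y = x")
        case False
        have "(y, x) \<in> (path_edges p)\<^sup>*" by (rule path_edges_connected[OF that p(2)])
        with False obtain z where "(y, z) \<in> path_edges p" by (auto elim: converse_rtranclE)
        then show ?thesis using path_edges_subset[OF sym_E lp] by blast
      qed (use x in simp)
      with p show ?thesis by blast
    qed
    moreover have "?W - I \<subseteq> \<Union>(set ` ?T)" using cov by (rule subsetI)
    moreover have "\<Union>(set ` ?T) \<subseteq> ?W" by blast
    ultimately show ?thesis using S(4) unfolding good_def by (intro exI[of _ ?T]) simp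
  qed
  then obtain \<S> where S: "good \<S>"
    \<comment> \<open>Both exchanges lower this sum: joining two paths saves a path, and extending a
      path covers one more vertex with equally many paths.\<close>
    and min: "\<And>\<T>. good \<T> \<Longrightarrow> card \<S> + card (?W - \<Union>(set ` \<S>)) \<le> card \<T> + card (?W - \<Union>(set ` \<T>))"
    using ex_has_least_nat[of good _ "\<lambda>\<S>. card \<S> + card (?W - \<Union>(set ` \<S>))"] by metis
  let ?U = "\<Union>(set ` \<S>)"
  have fam: "path_family \<S>" and cov: "?W - I \<subseteq> ?U" and UW: "?U \<subseteq> ?W"
    and card: "card \<S> + length vs \<le> card V"
    using S by (auto simp: good_def)
  have finS: "finite \<S>" and lp: "\<And>p. p \<in> \<S> \<Longrightarrow> link_path E p"
    and disj: "\<And>p q. p \<in> \<S> \<Longrightarrow> q \<in> \<S> \<Longrightarrow> p \<noteq> q \<Longrightarrow> set p \<inter> set q = {}"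
    using fam by (auto simp: path_family_def)
  \<comment> \<open>An uncovered vertex lies in \<open>I\<close>, so its neighbours are outside
    \<open>I\<close> and hence covered.\<close>
  have "\<forall>x\<in>?W - ?U. \<exists>p. p \<in> \<S> \<and> (\<exists>y\<in>set p. (x, y) \<in> E)"
  proof
    fix x assume x: "x \<in> ?W - ?U"
    then obtain y where y: "(x, y) \<in> E" by blast
    have "x \<in> I" using x cov by blast
    then have "y \<in> ?W - I" using indep y edge_sym by blast
    then show "\<exists>p. p \<in> \<S> \<and> (\<exists>y\<in>set p. (x, y) \<in> E)" using cov y by blast
  qed
  then obtain a where a: "\<And>x. x \<in> ?W - ?U \<Longrightarrow> a x \<in> \<S> \<and> (\<exists>y\<in>set (a x). (x, y) \<in> E)" by metis
  \<comment> \<open>Each uncovered vertex is hung on one adjacent path, which thereby becomes a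
    spine of its part.\<close>
  define part where "part p = set p \<union> {x \<in> ?W - ?U. a x = p}" for p
  have part_disj: "part p \<inter> part q = {}" if "p \<in> \<S>" "q \<in> \<S>" "p \<noteq> q" for p q
    using disj[OF that] that by (auto simp: part_def)
  have spine: "spine E (part p) p" if "p \<in> \<S>" for p
    using lp[OF that] a by (auto simp: spine_def part_def)
  have partition: "partition_on ?W (part ` \<S>)"
  proof (rule partition_onI)
    show "\<Union>(part ` \<S>) = ?W" using UW a by (auto simp: part_def) blast
    show "\<And>A B. A \<in> part ` \<S> \<Longrightarrow> B \<in> part ` \<S> \<Longrightarrow> A \<noteq> B \<Longrightarrow> disjnt A B"
      using part_disj by (auto simp: disjnt_def)
    show "{} \<notin> part ` \<S>" using lp by (auto simp: part_def link_path_def)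
  qed
  have leaf_edge: False
    if pq: "p \<in> \<S>" "q \<in> \<S>" "p \<noteq> q" and uv: "u \<in> part p" "v \<in> part q" "(u, v) \<in> E"
      and leaf: "\<exists>!y. y \<in> part p \<and> (u, y) \<in> E" "\<exists>!y. y \<in> part q \<and> (v, y) \<in> E" for p q u v
  proof -
    have ends: "u \<in> {hd p, last p}" if "u \<in> set p" "p \<in> \<S>" "\<exists>!y. y \<in> part p \<and> (u, y) \<in> E" for u p
      using unique_neighbour_is_end[OF lp[OF that(2)] _ that(1,3)] by (auto simp: part_def)
    \<comment> \<open>Reoriented to end in \<open>v\<close>, the path \<open>q\<close> can be
      prolonged by \<open>u\<close>, against minimality.\<close>
    have extend: False if ext: "u \<in> ?W - ?U" "q \<in> \<S>" "v \<in> {hd q, last q}" "(u, v) \<in> E" for u v q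
    proof -
      obtain r where r: "link_path E r" "set r = set q" "last r = v"
        using link_path_orient[OF sym_E lp[OF ext(2)] ext(3)] .
      have lr: "link_path E (r @ [u])"
        by (rule link_path_append) (use r ext edge_sym in auto)
      note repl = path_family_replace[OF fam ext(2) _ lr, of u]
      let ?T = "insert (r @ [u]) (\<S> - {q})"
      have "good ?T"
        unfolding good_def using repl r(2) ext cov UW card by auto
      moreover have "card (?W - \<Union>(set ` ?T)) < card (?W - ?U)"
        using repl(3) r(2) ext(1) finW by (intro psubset_card_mono) auto
      ultimately show False using min[of ?T] repl(2) r(2) ext(1) by auto
    qed
    consider "u \<in> set p" "v \<in> set q" | "u \<in> ?W - ?U" "v \<in> set q" | "u \<in> set p" "v \<in> ?W - ?U"
      | "u \<in> ?W - ?U" "v \<in> ?W - ?U"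
      using uv by (auto simp: part_def)
    then show False
    proof cases
      case 1
      obtain r where r: "link_path E r" "set r = set p" "last r = u"
        using link_path_orient[OF sym_E lp[OF pq(1)] ends[OF 1(1) pq(1) leaf(1)]] .
      obtain s where s: "link_path E s" "set s = set q" "last s = v"
        using link_path_orient[OF sym_E lp[OF pq(2)] ends[OF 1(2) pq(2) leaf(2)]] .
      have ls: "link_path E (r @ rev s)"
        by (rule link_path_append)
          (use r s uv disj[OF pq] link_path_rev' in \<open>auto simp: hd_rev\<close>)
      note join = path_family_join[OF fam pq ls]
      let ?T = "insert (r @ rev s) (\<S> - {p, q})"
      have st: "set (r @ rev s) = set p \<union> set q" using r s by simp
      have pos: "0 < card \<S>" using pq(1) finS by (auto simp: card_gt_0_iff)
      have "good ?T"
        unfolding good_def join(3)[OF st] using join(1,2)[OF st] cov UW card by auto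
      from min[OF this] show False
        unfolding join(3)[OF st] join(2)[OF st] using pos by simp
    next
      case 2
      then show ?thesis using extend pq(2) ends[OF _ pq(2) leaf(2)] uv(3) by blast
    next
      case 3
      then show ?thesis using extend pq(1) ends[OF _ pq(1) leaf(1)] edge_sym[OF uv(3)] by blast
    next
      case 4
      then show ?thesis using indep cov uv(3) by blast
    qed
  qed
  have no_leaf_edge: "\<not> ((\<exists>!y. y \<in> C \<and> (u, y) \<in> E) \<and> (\<exists>!y. y \<in> D \<and> (v, y) \<in> E))"
    if CD: "C \<in> part ` \<S>" "D \<in> part ` \<S>" "C \<noteq> D" and uv: "u \<in> C" "v \<in> D" "(u, v) \<in> E" for C D u v
  proof -
    obtain p q where pq: "p \<in> \<S>" "C = part p" "q \<in> \<S>" "D = part q" using CD(1,2) by blast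
    then have "p \<noteq> q" using CD(3) by blast
    with leaf_edge[OF pq(1,3)] uv show ?thesis unfolding pq(2,4) by blast
  qed
  have spines: "\<exists>p. spine E C p" if "C \<in> part ` \<S>" for C using spine that by blast
  have "spine_partition E (part ` \<S>)"
    unfolding spine_partition_def by (intro conjI ballI impI partition spines no_leaf_edge)
  moreover have "card (part ` \<S>) + length vs \<le> card V"
    using card card_image_le[OF finS, of part] by linarith
  ultimately show thesis using that by blast
qed

end

section \<open>Translation to the graph library\<close>

lemma (in wf_digraph) link_path_imp_awalk:
  assumes "link_path (arcs_ends G) p" "set p \<subseteq> verts G"
  obtains es where "awalk (hd p) es (last p)" "awalk_verts (hd p) es = p"
proof -
  from assms have "\<exists>es. awalk (hd p) es (last p) \<and> awalk_verts (hd p) es = p"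
  proof (induction p)
    case (Cons x p)
    show ?case
    proof (cases "p = []")
      case True
      with Cons show ?thesis by (intro exI[of _ "[]"]) (simp add: awalk_Nil_iff)
    next
      case False
      have adj: "(x # p) ! i \<rightarrow> (x # p) ! Suc i" if "Suc i < length (x # p)" for i
        using Cons.prems(1) that unfolding link_path_def by blast
      have "p ! i \<rightarrow> p ! Suc i" if "Suc i < length p" for i
        using adj[of "Suc i"] that by simp
      then have "link_path (arcs_ends G) p"
        using Cons.prems(1) False by (auto simp: link_path_def)
      with Cons obtain es where es: "awalk (hd p) es (last p)" "awalk_verts (hd p) es = p"
        by auto
      have "x \<rightarrow> hd p" using adj[of 0] False by (simp add: hd_conv_nth)
      then obtain e where "e \<in> arcs G" "tail G e = x" "head G e = hd p" by blast
      with es False show ?thesis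
        by (intro exI[of _ "e # es"]) (auto simp: awalk_Cons_iff)
    qed
  qed (simp add: link_path_def)
  with that show thesis by blast
qed

lemma link_path_mono: "\<lbrakk>link_path D p; D \<subseteq> E\<rbrakk> \<Longrightarrow> link_path E p"
  by (auto simp: link_path_def)

text \<open>If \<open>(x, y)\<close> is not in \<open>D\<close>, a simple \<open>D\<close>-path from
  \<open>x\<close> to \<open>y\<close> has at least three vertices, and closing it with an arc from
  \<open>y\<close> to \<open>x\<close> gives a forbidden cycle.\<close>

lemma undirected_forest_imp_forest_rel:
  assumes "undirected_forest F"
  shows "forest_rel (arcs_ends F)"
proof -
  interpret graph F using assms by (simp add: undirected_forest_def)
  have no_cycle: "length p < 3" if "cycle p" for p
    using assms that by (auto simp: undirected_forest_def)
  show ?thesis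
  proof
    show sym: "sym (arcs_ends F)" using sym_arcs by (simp add: symmetric_def)
    show irr: "(x, x) \<notin> arcs_ends F" for x using adj_not_same by blast
    fix D x y
    assume D: "D \<subseteq> arcs_ends F" "sym D" and xy: "(x, y) \<in> arcs_ends F" "(x, y) \<in> D\<^sup>*"
    obtain p where p: "link_path D p" "hd p = x" "last p = y"
      using rtrancl_imp_link_path[OF xy(2)] .
    show "(x, y) \<in> D"
    proof (rule ccontr)
      assume not: "(x, y) \<notin> D"
      have ne: "p \<noteq> []" "distinct p" using p(1) by (auto simp: link_path_def)
      \<comment> \<open>One vertex would make \<open>(x, y)\<close> a loop; two would put it into
        \<open>D\<close>.\<close>
      have "length p \<noteq> 1"
      proof
        assume "length p = 1"
        then have "x = y" using p(2,3) by (auto simp: length_Suc_conv)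
        with xy(1) irr show False by blast
      qed
      moreover have "length p \<noteq> 2"
      proof
        assume "length p = 2"
        then obtain b c where "p = [b, c]" by (auto simp: length_Suc_conv numeral_2_eq_2)
        with p not show False by (auto simp: link_path_def)
      qed
      moreover have "length p \<noteq> 0" using ne by simp
      ultimately have len: "3 \<le> length p" by linarith
      have pF: "link_path (arcs_ends F) p" using link_path_mono[OF p(1) D(1)] .
      have "set p \<subseteq> verts F"
      proof
        fix z assume z: "z \<in> set p"
        then have "(x, z) \<in> (path_edges p)\<^sup>*"
          using path_edges_connected[of x p z] p(2) ne by auto
        then have "(x, z) \<in> (arcs_ends F)\<^sup>*"
          using path_edges_subset[OF sym pF] rtrancl_mono by blast
        then show "z \<in> verts F"
          by (cases rule: rtranclE) (use xy(1) adj_in_verts in blast)+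
      qed
      then obtain es where es: "awalk x es y" "awalk_verts x es = p"
        using link_path_imp_awalk[OF pF] p(2,3) by auto
      have "y \<rightarrow>\<^bsub>F\<^esub> x" using xy(1) sym by (auto dest: symD)
      then obtain e where e: "e \<in> arcs F" "tail F e = y" "head F e = x" by blast
      then have "awalk y [e] x" using head_in_verts[of e] by (simp add: awalk_Cons_iff awalk_Nil_iff)
      with es(1) have w: "awalk x (es @ [e]) x" by (rule awalk_appendI)
      have "awalk_verts x (es @ [e]) = p @ [x]"
        using es p(3) e by (simp add: awalk_verts_append[OF w])
      moreover have "distinct (tl (p @ [x]))"
        using ne p(2) by (cases p) auto
      ultimately have "cycle (es @ [e])" using w by (auto simp: cycle_def)
      \<comment> \<open>The path has one arc fewer than vertices, and the closing arc makes up for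
        it.\<close>
      moreover have "length (es @ [e]) = length p"
        using es(2) length_awalk_verts[of x es] by simp
      ultimately show False using no_cycle len by fastforce
    qed
  qed
qed

section \<open>Induced subgraphs, distances and leaves\<close>

lemma arcs_ends_induce: "arcs_ends (F \<restriction> C) = arcs_ends F \<inter> C \<times> C"
  by (auto simp: arcs_ends_conv)

lemma undirected_forest_induce:
  assumes "undirected_forest F" "C \<subseteq> verts F"
  shows "undirected_forest (F \<restriction> C)"
proof -
  interpret graph F using assms by (simp add: undirected_forest_def)
  have ind: "induced_subgraph (F \<restriction> C) F" using induced_induce assms(2) by blast
  have fC: "finite C" using assms(2) finite_verts finite_subset by blast
  have g: "graph (F \<restriction> C)"
  proof
    show "symmetric (F \<restriction> C)"
      using sym_arcs by (auto simp: symmetric_def arcs_ends_induce sym_def)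
  qed (use fC no_loops no_multi_arcs in auto)
  have "\<not> (pre_digraph.cycle (F \<restriction> C) p \<and> 3 \<le> length p)" for p
    using subgraph_cycle[OF induced_imp_subgraph[OF ind]] assms(1)
    by (auto simp: undirected_forest_def)
  with g show ?thesis by (auto simp: undirected_forest_def)
qed

lemma vwalk_arcs_conv_nth: "set (vwalk_arcs p) = {(p ! i, p ! Suc i) | i. Suc i < length p}"
proof (induction p rule: vwalk_arcs.induct)
  case (3 x y xs)
  have "{((x # y # xs) ! i, (x # y # xs) ! Suc i) | i. Suc i < length (x # y # xs)} =
    insert (x, y) {((y # xs) ! i, (y # xs) ! Suc i) | i. Suc i < length (y # xs)}"
    (is "?L = ?R")
  proof
    show "?L \<subseteq> ?R"
    proof
      fix z assume "z \<in> ?L"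
      then obtain i where "z = ((x # y # xs) ! i, (x # y # xs) ! Suc i)" "Suc i < length (x # y # xs)"
        by blast
      then show "z \<in> ?R" by (cases i) auto
    qed
    show "?R \<subseteq> ?L" by (force intro: exI[of _ 0] exI[of _ "Suc _"])
  qed
  with 3 show ?case by simp
qed auto

lemma vpath_iff_link_path: "vpath p G \<longleftrightarrow> link_path (arcs_ends G) p \<and> set p \<subseteq> verts G"
  by (auto simp: vpath_def vwalk_def link_path_def vwalk_arcs_conv_nth)

lemma vpath_induce_iff:
  "vpath p (F \<restriction> C) \<longleftrightarrow> link_path (arcs_ends F) p \<and> set p \<subseteq> C"
  by (auto simp: vpath_iff_link_path arcs_ends_induce link_path_def)

lemma graph_dist_le_1_iff:
  assumes "wf_digraph G" "u \<in> verts G"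
  shows "graph_dist G u v \<le> 1 \<longleftrightarrow> u = v \<or> u \<rightarrow>\<^bsub>G\<^esub> v"
proof -
  interpret wf_digraph G by fact
  have cost: "awalk_cost (\<lambda>_. 1) p = real (length p)" for p :: "'b list"
    by (induction p) auto
  show ?thesis
  proof
    assume "graph_dist G u v \<le> 1"
    \<comment> \<open>The strict bound 2 turns the infimum into an actual walk of cost below 2, that
      is, of at most one arc.\<close>
    then have "\<mu> (\<lambda>_. 1) u v < 2"
      unfolding graph_dist_def by (rule le_less_trans) simp
    then obtain p where p: "awalk u p v" "ereal (awalk_cost (\<lambda>_. 1) p) < 2"
      unfolding \<mu>_def by (auto simp: INF_less_iff)
    then have "length p < 2" by (simp add: cost)
    then consider "p = []" | e where "p = [e]" by (cases p; cases "tl p") auto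
    then show "u = v \<or> u \<rightarrow>\<^bsub>G\<^esub> v"
      using p(1) by cases (auto simp: awalk_Nil_iff awalk_Cons_iff arcs_ends_conv)
  next
    assume "u = v \<or> u \<rightarrow>\<^bsub>G\<^esub> v"
    then obtain p where "awalk u p v" "length p \<le> 1"
    proof
      assume "u = v"
      with assms(2) show thesis by (intro that[of "[]"]) (auto simp: awalk_Nil_iff)
    next
      assume "u \<rightarrow>\<^bsub>G\<^esub> v"
      then obtain e where "e \<in> arcs G" "tail G e = u" "head G e = v" by blast
      then show thesis by (intro that[of "[e]"]) (auto simp: awalk_Cons_iff awalk_Nil_iff)
    qed
    then show "graph_dist G u v \<le> 1"
      unfolding graph_dist_def
      by (intro order_trans[OF min_cost_le_walk_cost]) (auto simp: cost)
  qed
qed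

text \<open>The longest path in the definition of a caterpillar is itself a spine. Conversely, a
  given spine may be too short, but \<open>spine_imp_longest_spine\<close> provides one of greatest
  length among all paths in \<open>C\<close>; connectedness comes from routing through it.\<close>

lemma caterpillar_iff_spine:
  assumes F: "undirected_forest F" and C: "C \<subseteq> verts F"
  shows "caterpillar (F \<restriction> C) \<longleftrightarrow> (\<exists>p. spine (arcs_ends F) C p)"
proof -
  have uf: "undirected_forest (F \<restriction> C)" using undirected_forest_induce[OF F C] .
  interpret H: graph "F \<restriction> C" using uf by (simp add: undirected_forest_def)
  interpret forest_rel "arcs_ends F" using undirected_forest_imp_forest_rel[OF F] .
  have finC: "finite C" using H.finite_verts by simp
  have near: "graph_dist (F \<restriction> C) x y \<le> 1 \<longleftrightarrow> x = y \<or> (x, y) \<in> arcs_ends F"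
    if "x \<in> C" "y \<in> C" for x y
    using graph_dist_le_1_iff[OF H.wf_digraph, of x y] that by (auto simp: arcs_ends_induce)
  show ?thesis
  proof
    assume "caterpillar (F \<restriction> C)"
    then obtain p where p: "vpath p (F \<restriction> C)" "\<And>v. v \<in> C \<Longrightarrow> \<exists>u\<in>set p. graph_dist (F \<restriction> C) v u \<le> 1"
      by (auto simp: caterpillar_def longest_path_def)
    from p(1) have lp: "link_path (arcs_ends F) p" "set p \<subseteq> C" by (auto simp: vpath_induce_iff)
    have "\<exists>y\<in>set p. (x, y) \<in> arcs_ends F" if x: "x \<in> C - set p" for x
    proof -
      obtain u where u: "u \<in> set p" "graph_dist (F \<restriction> C) x u \<le> 1" using p(2) x by blast
      with near[of x u] x lp(2) show ?thesis by auto
    qed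
    with lp show "\<exists>p. spine (arcs_ends F) C p" by (auto simp: spine_def)
  next
    assume "\<exists>p. spine (arcs_ends F) C p"
    then obtain p where p: "spine (arcs_ends F) C p"
      and max: "\<And>q. \<lbrakk>link_path (arcs_ends F) q; set q \<subseteq> C\<rbrakk> \<Longrightarrow> length q \<le> length p"
      using spine_imp_longest_spine[OF finC] by blast
    have lp: "link_path (arcs_ends F) p" "set p \<subseteq> C" "p \<noteq> []"
      using p by (auto simp: spine_def link_path_def)
    have "longest_path (F \<restriction> C) p"
      unfolding longest_path_def using lp max by (auto simp: vpath_induce_iff intro: diff_le_mono)
    moreover have dom: "\<exists>u\<in>set p. v = u \<or> (v, u) \<in> arcs_ends F" if "v \<in> C" for v
      using p that by (auto simp: spine_def)
    then have "\<forall>v\<in>C. \<exists>u\<in>set p. graph_dist (F \<restriction> C) v u \<le> 1"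
      using near lp(2) by (meson subsetD)
    moreover have "connected (F \<restriction> C)"
    proof -
      let ?H = "arcs_ends (F \<restriction> C)"
      have sH: "sym ?H" using H.sym_arcs by (simp add: symmetric_def)
      have pH: "path_edges p \<subseteq> ?H"
        using path_edges_subset[OF sym_E lp(1)] lp(2)
        by (auto simp: arcs_ends_induce dest: path_edges_in_set)
      have star: "(x, y) \<in> ?H\<^sup>*" if xy: "x \<in> C" "y \<in> C" for x y
      proof -
        have to: "\<exists>u\<in>set p. (x, u) \<in> ?H\<^sup>*" if x: "x \<in> C" for x
        proof -
          obtain u where "u \<in> set p" "x = u \<or> (x, u) \<in> arcs_ends F" using dom x by blast
          then show ?thesis using lp(2) x by (auto simp: arcs_ends_induce)
        qed
        obtain u where u: "u \<in> set p" "(x, u) \<in> ?H\<^sup>*" using to xy by blast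
        obtain w where w: "w \<in> set p" "(y, w) \<in> ?H\<^sup>*" using to xy by blast
        have "(u, w) \<in> ?H\<^sup>*"
          using path_edges_connected[OF u(1) w(1)] rtrancl_mono[OF pH] by blast
        moreover have "(w, y) \<in> ?H\<^sup>*" using w(2) sym_rtrancl[OF sH] by (auto dest: symD)
        ultimately show ?thesis using u(2) by (meson rtrancl_trans)
      qed
      have "x \<rightarrow>\<^sup>*\<^bsub>F \<restriction> C\<^esub> y" if "x \<in> C" "y \<in> C" for x y
        using star[OF that] that by (auto simp: rtrancl_eq_or_trancl intro: H.reachable1_reachable)
      then have "(x, y) \<in> rtrancl_on C (?H\<^sup>s)" if "x \<in> C" "y \<in> C" for x y
        using that rtrancl_on_mono[of ?H "?H\<^sup>s" C C x y]
        by (auto simp: reachable_def symcl_def)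
      moreover have "C \<noteq> {}" using lp by auto
      ultimately show ?thesis by (simp add: connected_conv)
    qed
    ultimately show "caterpillar (F \<restriction> C)"
      using uf by (auto simp: caterpillar_def undirected_tree_def)
  qed
qed

text \<open>Without parallel arcs \<open>out_degree\<close> counts neighbours, so degree 1 means a
  unique neighbour within \<open>C\<close>.\<close>

lemma non_leaf_induce_iff:
  assumes "graph F" "u \<in> C"
  shows "non_leaf (F \<restriction> C) u \<longleftrightarrow> \<not> (\<exists>!y. y \<in> C \<and> u \<rightarrow>\<^bsub>F\<^esub> y)"
proof -
  interpret graph F by fact
  have "inj_on (head F) (out_arcs (F \<restriction> C) u)"
    using no_multi_arcs by (auto simp: inj_on_def out_arcs_def arc_to_ends_def)
  moreover have "head F ` out_arcs (F \<restriction> C) u = {y \<in> C. u \<rightarrow>\<^bsub>F\<^esub> y}"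
    using assms(2) by (auto simp: out_arcs_def arcs_ends_conv image_iff)
  ultimately have "out_degree (F \<restriction> C) u = card {y \<in> C. u \<rightarrow>\<^bsub>F\<^esub> y}"
    unfolding out_degree_def by (metis card_image)
  moreover have "card {y \<in> C. u \<rightarrow>\<^bsub>F\<^esub> y} = 1 \<longleftrightarrow> (\<exists>!y. y \<in> C \<and> u \<rightarrow>\<^bsub>F\<^esub> y)"
    unfolding One_nat_def card_1_singleton_iff by (auto simp: set_eq_iff) metis+
  ultimately show ?thesis using assms(2) by (simp add: non_leaf_def)
qed

lemma caterpillar_partition_iff_spine_partition:
  assumes F: "undirected_forest F"
  shows "caterpillar_partition F Q \<longleftrightarrow> spine_partition (arcs_ends F) Q"
proof -
  interpret graph F using F by (simp add: undirected_forest_def)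
  have W: "non_isolated_verts F = Domain (arcs_ends F)"
    using adj_in_verts by (auto simp: non_isolated_verts_def)
  \<comment> \<open>Both sides contain the partition clause. Assuming it first makes every part a
    subset of \<open>verts F\<close>, as \<open>caterpillar_iff_spine\<close> demands.\<close>
  have "caterpillar_partition F Q \<longleftrightarrow> spine_partition (arcs_ends F) Q"
    if part: "partition_on (Domain (arcs_ends F)) Q"
  proof -
    have "C \<subseteq> verts F" if "C \<in> Q" for C
      using partition_onD1[OF part] that adj_in_verts by blast
    then have "caterpillar (F \<restriction> C) \<longleftrightarrow> (\<exists>p. spine (arcs_ends F) C p)" if "C \<in> Q" for C
      using caterpillar_iff_spine[OF F] that by simp
    then have "(\<forall>C\<in>Q. caterpillar (F \<restriction> C)) \<longleftrightarrow> (\<forall>C\<in>Q. \<exists>p. spine (arcs_ends F) C p)"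
      by simp
    moreover have "(\<forall>u\<in>C. \<forall>v\<in>D. u \<rightarrow>\<^bsub>F\<^esub> v \<longrightarrow> non_leaf (F \<restriction> C) u \<or> non_leaf (F \<restriction> D) v) \<longleftrightarrow>
      (\<forall>u\<in>C. \<forall>v\<in>D. u \<rightarrow>\<^bsub>F\<^esub> v \<longrightarrow> \<not> ((\<exists>!y. y \<in> C \<and> u \<rightarrow>\<^bsub>F\<^esub> y) \<and> (\<exists>!y. y \<in> D \<and> v \<rightarrow>\<^bsub>F\<^esub> y)))" for C D
      using non_leaf_induce_iff[OF graph_axioms] by (simp cong: ball_cong)
    ultimately show ?thesis
      using part by (simp add: caterpillar_partition_def spine_partition_def W)
  qed
  moreover have "partition_on (Domain (arcs_ends F)) Q" if "caterpillar_partition F Q"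
    using that by (simp add: caterpillar_partition_def W)
  moreover have "partition_on (Domain (arcs_ends F)) Q" if "spine_partition (arcs_ends F) Q"
    using that by (simp add: spine_partition_def)
  ultimately show ?thesis by blast
qed

lemma legal_sequence_iff_footprints:
  "legal_sequence F vs \<longleftrightarrow> set vs \<subseteq> verts F \<and> (\<exists>f. footprints (arcs_ends F) vs f)"
proof -
  have "(closed_nbhd F (vs ! i) - (\<Union>j<i. closed_nbhd F (vs ! j)) \<noteq> {}) \<longleftrightarrow>
    (\<exists>y. (y = vs ! i \<or> vs ! i \<rightarrow>\<^bsub>F\<^esub> y) \<and> (\<forall>j<i. y \<noteq> vs ! j \<and> \<not> vs ! j \<rightarrow>\<^bsub>F\<^esub> y))" for i
    by (auto simp: closed_nbhd_def)
  moreover have "(\<forall>i<n. \<exists>y. R i y) \<longleftrightarrow> (\<exists>f. \<forall>i<n. R i (f i))" for n :: nat and R :: "nat \<Rightarrow> 'a \<Rightarrow> bool"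
    by metis
  ultimately show ?thesis
    unfolding legal_sequence_def footprints_def by simp
qed

theorem theorem3p9:
  fixes F :: "('a,'b) pre_digraph" and P :: "'a set set"
  assumes "undirected_forest F"
    and "minimum_caterpillar_partition F P"
  shows "int (grundy_domination_number F) = int (card (verts F)) - int (card P)"
proof -
  interpret graph F using assms(1) by (simp add: undirected_forest_def)
  interpret forest_rel "arcs_ends F" using undirected_forest_imp_forest_rel[OF assms(1)] .
  have EV: "arcs_ends F \<subseteq> verts F \<times> verts F" using adj_in_verts by auto
  have P: "spine_partition (arcs_ends F) P"
    and min: "\<And>Q. spine_partition (arcs_ends F) Q \<Longrightarrow> card P \<le> card Q"
    using assms by (auto simp: minimum_caterpillar_partition_def caterpillar_partition_iff_spine_partition)
  obtain vs f where vs: "set vs \<subseteq> verts F" "footprints (arcs_ends F) vs f"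
    "length vs + card P = card (verts F)"
    using spine_partition_imp_footprints[OF finite_verts EV P] .
  have legal: "legal_sequence F vs" using vs by (auto simp: legal_sequence_iff_footprints)
  \<comment> \<open>The partition obtained from \<open>ws\<close> has at least \<open>card P\<close>
    parts, which bounds \<open>length ws\<close> by the length already attained.\<close>
  have upper: "length ws \<le> length vs" if ws: "legal_sequence F ws" for ws
  proof -
    obtain g where "set ws \<subseteq> verts F" "footprints (arcs_ends F) ws g"
      using ws by (auto simp: legal_sequence_iff_footprints)
    then obtain Q where Q: "spine_partition (arcs_ends F) Q" "card Q + length ws \<le> card (verts F)"
      using footprints_imp_spine_partition[OF finite_verts EV] by blast
    with min[OF Q(1)] vs(3) show ?thesis by linarith
  qed
  have "grundy_domination_number F = length vs"
    unfolding grundy_domination_number_def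
  proof (rule Max_eqI)
    show "finite {length vs | vs. legal_sequence F vs}"
      by (rule finite_subset[of _ "{..length vs}"]) (use upper in auto)
  qed (use upper legal in auto)
  with vs(3) show ?thesis by linarith
qed

end
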